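(* Suppose Assumptions 1 and 2 (listed in the context) hold, and let $\{w^k\}_{k\ge 0}=\{(u^k,v^k,p^k)\}_{k\ge0}$ be a sequence generated by the algorithm NAPP-AL (described in the context) where at every iteration $k$ one sets $$\delta_k := \beta \left(L_G+\|q^k\|L_{\Omega}+\gamma (L^0_{\Theta})^2+\frac{14\gamma\|B\|^2(L^0_{\Theta})^2}{\lambda_{\min}(B^{\top}B)}+\frac{14(L_G+\gamma\|B\| L^0_{\Theta})^2}{\gamma\lambda_{\min}(B^{\top}B)}+1\right)^{-1}.$$ For $k\ge 1$ define $$\Lambda^k := \mathcal{L}_{\gamma}(u^k,v^k,p^k)+c_1 \|u^{k-1}-u^k\|^2+c_2 \|v^{k-1}-v^{k}\|^2+\frac{1}{2\gamma}\|p^{k-1}-p^k\|^2,$$ with $c_1:=\frac{7(L_G+\gamma\|B\|L^0_{\Theta})^2}{\gamma\lambda_{\min}(B^{\top}B)}$ and $c_2:=\frac{7(L_G+L_H)^2}{\gamma\lambda_{\min}(B^{\top}B)}$, and let $\Lambda^*=\lim_{k\to\infty}\Lambda^k$ (this limit exists in $\mathbf{R}$ when Assumptions 1 and 2 hold and $\delta_k$ is given by the displayed formula). Let $\bar w$ be an accumulation point of $\{w^k\}$ with $\mathcal{L}_{\gamma}(\bar w)=\Lambda^*$, and assume that the value proximity error bound (VP-EB) condition (defined in the context) holds at $\bar w$ with constants $\eta>0$, $\nu>0$ and $\kappa_1>0$. Then: (i) there is $k_0$ such that $w^k\in\mathbb{B}(\bar w;\eta)$ and $\mathcal{L}_{\gamma}(w^k)<\Lambda^*+\nu$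 for all $k\ge k_0$; (ii) $\sum_{k=0}^{\infty}\|w^k-w^{k+1}\|<+\infty$; (iii) the whole sequence $\{w^k\}$ converges to $\bar w$, which is a stationary point of (P); (iv) $\{\Lambda^k\}$ converges to $\Lambda^*$ at a Q-linear rate: there are $\alpha\in(0,1)$ and $k_0$ such that $\Lambda^{k+1}-\Lambda^*\le\alpha(\Lambda^k-\Lambda^* )$ for all $k\ge k_0$. Moreover, $\{w^k\}$ converges at an R-linear rate to the stationary point $\bar w$ (i.e. there are $C>0$ and $\rho\in(0,1)$ with $\|w^k-\bar w\|\le C\rho^k$ for all sufficiently large $k$).
   Context: Problem (P): minimize $F(u,v):=G(u,v)+J(u)+H(v)$ subject to $\Theta(u)+Bv=0$, $u\in\mathbf{U}$, $v\in\mathbf{R}^d$, where $\mathbf{U}\subseteq\mathbf{R}^n$ is nonempty, closed and convex, $\Theta=\Omega+\Phi:\mathbf{R}^n\to\mathbf{R}^m$ with $\Omega,\Phi$ differentiable, and $B\in\mathbf{R}^{m\times d}$. $\|\cdot\|$ is the Euclidean norm (spectral norm for matrices), $\lambda_{\min}$ the smallest eigenvalue. Assumption 1. (H1) $G:\mathbf{R}^n\times\mathbf{R}^d\to\mathbf{R}$ is differentiable (possibly nonconvex) with $L_G$-Lipschitz gradient. (H2) $H:\mathbf{R}^d\to\mathbf{R}$ is differentiable (possibly nonconvex) with $L_H$-Lipschitz gradient. (H3) $J:\mathbf{R}^n\to(-\infty,+\infty]$ is proper and lower semicontinuous (possibly nonconvex); if $\mathbf{U}=\mathbf{R}^n$,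 ${\rm dom}(J)$ is convex; if $\mathbf{U}\neq\mathbf{R}^n$, $J$ is locally Lipschitz continuous around every point of ${\rm dom}(J)\cap\mathbf{U}$. (H4) $\|\Theta(u)-\Theta(u')\|\le L^0_\Theta\|u-u'\|$ for all $u,u'$. (H5) $\Omega=(\Omega_1,\dots,\Omega_m)^\top$ where each $\Omega_j:\mathbf{R}^n\to\mathbf{R}$ has $L_{\Omega_j}$-Lipschitz gradient; $L_\Omega:=\sum_{j=1}^m L_{\Omega_j}$. (H6) $B$ is a tall matrix of full column rank and ${\rm Im}(\Theta)\subseteq{\rm Im}(B)$. (H7) $F$ is bounded below and coercive over $\{(u,v)\in\mathbf{R}^n\times\mathbf{R}^d:\Theta(u)+Bv=0\}$ (coercive: $F(u,v)\to+\infty$ as $\|(u,v)\|\to\infty$ within this set). Assumption 2. (i) $K:\mathbf{R}^n\to\mathbf{R}$ is differentiable, $\beta$-strongly convex ($\beta>0$), with $L_K$-Lipschitz gradient. (ii) $\gamma>\frac{\sqrt{57}+1}{2\lambda_{\min}(B^\top B)}(L_G+L_H)$ (and $\gamma>0$). Bregman distance: $D(u,u')=K(u)-K(u')-\langle\nabla K(u'),u-u'\rangle$. Algorithm NAPP-AL. Fix $\sigma\in(0,1)$ and start from $u^0\in\mathbf{R}^n,v^0\in\mathbf{R}^d,p^0\in\mathbf{R}^m$. For $k=0,1,2,\dots$: set $q^k=p^k+\gamma(\Theta(u^k)+Bv^k)$, take $\delta_k>0$ and $\epsilon^k$ with $\sigma\delta_k\le\epsilon^k\le\delta_k$, and let $$u^{k+1}\in\arg\min_{u\in\mathbf{U}}\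 \langle\nabla_uG(u^k,v^k),u\rangle+J(u)+\langle q^k,\nabla\Omega(u^k)u+\Phi(u)\rangle+\tfrac1{\epsilon^k}D(u,u^k),$$ $$v^{k+1}=\arg\min_{v\in\mathbf{R}^d}\ \langle\nabla_vG(u^k,v^k)+\nabla H(v^k),v\rangle+\langle q^k,Bv\rangle+\tfrac\gamma2\|B(v-v^k)\|^2,$$ $$p^{k+1}=p^k+\gamma(\Theta(u^{k+1})+Bv^{k+1}).$$ The $u$-subproblem is assumed to be solved to global optimality (a global minimizer is assumed to exist). Write $w^k=(u^k,v^k,p^k)$. Augmented Lagrangian: for $w=(u,v,p)$, $\mathcal{L}_\gamma(w)=F(u,v)+\langle p,\Theta(u)+Bv\rangle+\frac\gamma2\|\Theta(u)+Bv\|^2$. A point $w\in\mathbf{U}\times\mathbf{R}^d\times\mathbf{R}^m$ is a stationary point of (P) if $0\in\nabla_uG(u,v)+\partial J(u)+\mathcal{N}_{\mathbf{U}}(u)+(\nabla\Theta(u))^\top p$, $0=\nabla_vG(u,v)+\nabla H(v)+B^\top p$ and $\Theta(u)+Bv=0$, where $\partial J$ is the limiting (Mordukhovich) subdifferential and $\mathcal{N}_{\mathbf{U}}(u)=\{\xi:\langle\xi,\zeta-u\rangle\le0\ \forall\zeta\in\mathbf{U}\}$. $\mathbb{B}(\bar w;\eta)$ is the open ball of radius $\eta$ centered at $\bar w$. VP-EB condition at $\bar w$ (a stationary point of (P) with $\mathcal{L}_\gamma(\bar w)=\Lambda^*$) for the sequence $\{w^k\}$: there exist $\kappa_1>0,\eta>0,\nu>0$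 such that $\mathcal{L}_\gamma(w^{k+1})-\Lambda^*\le\kappa_1\|w^k-w^{k+1}\|^2$ for every $k$ with $w^{k+1}\in\mathbb{B}(\bar w;\eta)$ and $\mathcal{L}_\gamma(w^{k+1})<\Lambda^*+\nu$. *)

theory Defs
  imports "HOL-Analysis.Analysis"
begin

section \<open>Gradients, strong convexity, eigenvalues\<close>

definition gradient :: "('a::real_inner \<Rightarrow> real) \<Rightarrow> 'a \<Rightarrow> 'a" where
  "gradient f x = (THE D. GDERIV f x :> D)"

definition lipschitz_gradient :: "real \<Rightarrow> ('a::real_inner \<Rightarrow> real) \<Rightarrow> bool" where
  "lipschitz_gradient L f \<longleftrightarrow>
     (\<forall>x. f differentiable (at x)) \<and> L-lipschitz_on UNIV (gradient f)"

definition strongly_convex :: "real \<Rightarrow> ('a::real_inner \<Rightarrow> real) \<Rightarrow> bool" where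
  "strongly_convex b f \<longleftrightarrow>
     (\<forall>x y. \<forall>t\<in>{0..1}.
        f (t *\<^sub>R x + (1 - t) *\<^sub>R y)
          \<le> t * f x + (1 - t) * f y - b / 2 * t * (1 - t) * (norm (x - y))\<^sup>2)"

definition eigenvalue_of :: "real ^ 'n ^ 'n \<Rightarrow> real \<Rightarrow> bool" where
  "eigenvalue_of A l \<longleftrightarrow> (\<exists>x. x \<noteq> 0 \<and> A *v x = l *\<^sub>R x)"

definition lambda_min :: "real ^ 'n ^ 'n \<Rightarrow> real" where
  "lambda_min A = (LEAST l. eigenvalue_of A l)"

abbreviation spectral_norm :: "real ^ 'n ^ 'm \<Rightarrow> real" where
  "spectral_norm A \<equiv> onorm ((*v) A)"

definition bregman :: "('a::real_inner \<Rightarrow> real) \<Rightarrow> 'a \<Rightarrow> 'a \<Rightarrow> real" where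
  "bregman K x y = K x - K y - gradient K y \<bullet> (x - y)"


section \<open>Extended-real-valued functions and subdifferentials\<close>

definition edom :: "('a \<Rightarrow> ereal) \<Rightarrow> 'a set" where
  "edom f = {x. f x < \<infinity>}"

definition proper :: "('a \<Rightarrow> ereal) \<Rightarrow> bool" where
  "proper f \<longleftrightarrow> (\<forall>x. f x \<noteq> -\<infinity>) \<and> edom f \<noteq> {}"

definition lsc :: "('a::topological_space \<Rightarrow> ereal) \<Rightarrow> bool" where
  "lsc f \<longleftrightarrow> (\<forall>x. f x \<le> Liminf (at x) f)"

text \<open>The neighbourhood is taken in the whole space, so \<open>f\<close> is finite near \<open>x\<close>.\<close>

definition lipschitz_around :: "('a::metric_space \<Rightarrow> ereal) \<Rightarrow> 'a \<Rightarrow> bool" where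
  "lipschitz_around f x \<longleftrightarrow>
     (\<exists>r>0. \<exists>L. (\<forall>y\<in>ball x r. \<bar>f y\<bar> \<noteq> \<infinity>) \<and>
        L-lipschitz_on (ball x r) (\<lambda>y. real_of_ereal (f y)))"

definition frechet_subdiff :: "('a::real_inner \<Rightarrow> ereal) \<Rightarrow> 'a \<Rightarrow> 'a set" where
  "frechet_subdiff f x =
     {\<xi>. \<bar>f x\<bar> \<noteq> \<infinity> \<and>
         0 \<le> Liminf (at x) (\<lambda>y. (f y - f x - ereal (\<xi> \<bullet> (y - x))) / ereal (norm (y - x)))}"

text \<open>Limiting (Mordukhovich) subdifferential.\<close>

definition limiting_subdiff :: "('a::real_inner \<Rightarrow> ereal) \<Rightarrow> 'a \<Rightarrow> 'a set" where
  "limiting_subdiff f x =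
     {\<xi>. \<bar>f x\<bar> \<noteq> \<infinity> \<and>
         (\<exists>y \<zeta>. y \<longlonglongrightarrow> x \<and> (\<lambda>k. f (y k)) \<longlonglongrightarrow> f x \<and>
                (\<forall>k. \<zeta> k \<in> frechet_subdiff f (y k)) \<and> \<zeta> \<longlonglongrightarrow> \<xi>)}"

definition normal_cone :: "'a::real_inner set \<Rightarrow> 'a \<Rightarrow> 'a set" where
  "normal_cone U u = {\<xi>. \<forall>\<zeta>\<in>U. \<xi> \<bullet> (\<zeta> - u) \<le> 0}"


section \<open>The problem, its augmented Lagrangian and the algorithm\<close>

text \<open>
  Minimize \<open>G (u, v) + J u + H v\<close> subject to \<open>\<Theta> u + B v = 0\<close>, \<open>u \<in> U\<close>.
\<close>

definition objective ::
  "((real^'n) \<times> (real^'d) \<Rightarrow> real) \<Rightarrow> (real^'n \<Rightarrow> ereal) \<Rightarrow> (real^'d \<Rightarrow> real)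
     \<Rightarrow> (real^'n) \<times> (real^'d) \<Rightarrow> ereal" where
  "objective G J H = (\<lambda>(u, v). ereal (G (u, v)) + J u + ereal (H v))"

definition constraint_set ::
  "(real^'n \<Rightarrow> real^'m) \<Rightarrow> real^'d^'m \<Rightarrow> ((real^'n) \<times> (real^'d)) set" where
  "constraint_set \<Theta> B = {(u, v). \<Theta> u + B *v v = 0}"

definition bounded_below_over :: "('a \<Rightarrow> ereal) \<Rightarrow> 'a set \<Rightarrow> bool" where
  "bounded_below_over f S \<longleftrightarrow> (\<exists>c::real. \<forall>x\<in>S. ereal c \<le> f x)"

definition coercive_over :: "('a::real_normed_vector \<Rightarrow> ereal) \<Rightarrow> 'a set \<Rightarrow> bool" where
  "coercive_over f S \<longleftrightarrow> (f \<longlongrightarrow> \<infinity>) (inf at_infinity (principal S))"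

definition aug_lagrangian ::
  "((real^'n) \<times> (real^'d) \<Rightarrow> real) \<Rightarrow> (real^'n \<Rightarrow> ereal) \<Rightarrow> (real^'d \<Rightarrow> real)
     \<Rightarrow> (real^'n \<Rightarrow> real^'m) \<Rightarrow> real^'d^'m \<Rightarrow> real
     \<Rightarrow> (real^'n) \<times> (real^'d) \<times> (real^'m) \<Rightarrow> ereal" where
  "aug_lagrangian G J H \<Theta> B \<gamma> = (\<lambda>(u, v, p).
     objective G J H (u, v) +
     ereal (p \<bullet> (\<Theta> u + B *v v) + \<gamma> / 2 * (norm (\<Theta> u + B *v v))\<^sup>2))"

definition stationary_point ::
  "(real^'n) set \<Rightarrow> ((real^'n) \<times> (real^'d) \<Rightarrow> real) \<Rightarrow> (real^'n \<Rightarrow> ereal) \<Rightarrow> (real^'d \<Rightarrow> real)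
     \<Rightarrow> (real^'n \<Rightarrow> real^'m) \<Rightarrow> real^'d^'m \<Rightarrow> (real^'n) \<times> (real^'d) \<times> (real^'m) \<Rightarrow> bool" where
  "stationary_point U G J H \<Theta> B = (\<lambda>(u, v, p).
     u \<in> U \<and>
     0 \<in> {gradient (\<lambda>x. G (x, v)) u + \<xi> + \<zeta> + transpose (jacobian \<Theta> (at u)) *v p | \<xi> \<zeta>.
            \<xi> \<in> limiting_subdiff J u \<and> \<zeta> \<in> normal_cone U u} \<and>
     0 = gradient (\<lambda>y. G (u, y)) v + gradient H v + transpose B *v p \<and>
     \<Theta> u + B *v v = 0)"

definition q_seq ::
  "(real^'n \<Rightarrow> real^'m) \<Rightarrow> real^'d^'m \<Rightarrow> real
     \<Rightarrow> (nat \<Rightarrow> real^'n) \<Rightarrow> (nat \<Rightarrow> real^'d) \<Rightarrow> (nat \<Rightarrow> real^'m) \<Rightarrow> nat \<Rightarrow> real^'m" where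
  "q_seq \<Theta> B \<gamma> u v p k = p k + \<gamma> *\<^sub>R (\<Theta> (u k) + B *v v k)"

text \<open>
  \<open>napp_al\<close> says that \<open>(u, v, p)\<close> is a run of NAPP-AL for \<open>\<Theta> = \<Omega> + \<Phi>\<close> with step parameters
  \<open>\<sigma>\<close>, \<open>\<delta>\<close>, \<open>\<epsilon>\<close>; both subproblems are solved to global optimality.
\<close>

definition napp_al ::
  "(real^'n) set \<Rightarrow> ((real^'n) \<times> (real^'d) \<Rightarrow> real) \<Rightarrow> (real^'n \<Rightarrow> ereal) \<Rightarrow> (real^'d \<Rightarrow> real)
     \<Rightarrow> (real^'n \<Rightarrow> real^'m) \<Rightarrow> (real^'n \<Rightarrow> real^'m) \<Rightarrow> real^'d^'m
     \<Rightarrow> (real^'n \<Rightarrow> real) \<Rightarrow> real \<Rightarrow> real \<Rightarrow> (nat \<Rightarrow> real) \<Rightarrow> (nat \<Rightarrow> real)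
     \<Rightarrow> (nat \<Rightarrow> real^'n) \<Rightarrow> (nat \<Rightarrow> real^'d) \<Rightarrow> (nat \<Rightarrow> real^'m) \<Rightarrow> bool" where
  "napp_al U G J H \<Omega> \<Phi> B K \<gamma> \<sigma> \<delta> \<epsilon> u v p \<longleftrightarrow>
     0 < \<sigma> \<and> \<sigma> < 1 \<and>
     (\<forall>k. let \<Theta> = (\<lambda>x. \<Omega> x + \<Phi> x);
              q = q_seq \<Theta> B \<gamma> u v p k
          in 0 < \<delta> k \<and> \<sigma> * \<delta> k \<le> \<epsilon> k \<and> \<epsilon> k \<le> \<delta> k \<and>
             is_arg_min
               (\<lambda>x. ereal (gradient (\<lambda>x'. G (x', v k)) (u k) \<bullet> x) + J x +
                    ereal (q \<bullet> (jacobian \<Omega> (at (u k)) *v x + \<Phi> x)) +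
                    ereal (1 / \<epsilon> k * bregman K x (u k)))
               (\<lambda>x. x \<in> U) (u (Suc k)) \<and>
             is_arg_min
               (\<lambda>y. (gradient (\<lambda>y'. G (u k, y')) (v k) + gradient H (v k)) \<bullet> y +
                    q \<bullet> (B *v y) + \<gamma> / 2 * (norm (B *v (y - v k)))\<^sup>2)
               (\<lambda>y. True) (v (Suc k)) \<and>
             p (Suc k) = p k + \<gamma> *\<^sub>R (\<Theta> (u (Suc k)) + B *v v (Suc k)))"

text \<open>
  Value proximity error bound at \<open>wbar\<close> for the sequence \<open>w\<close>, with \<open>L\<close> the augmented Lagrangian
  and \<open>Ls\<close> the limit value.
\<close>

definition vp_eb ::
  "('w::real_normed_vector \<Rightarrow> ereal) \<Rightarrow> real \<Rightarrow> (nat \<Rightarrow> 'w) \<Rightarrow> 'w \<Rightarrow> real \<Rightarrow> real \<Rightarrow> real \<Rightarrow> bool"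
where
  "vp_eb L Ls w wbar \<kappa> \<eta> \<nu> \<longleftrightarrow>
     \<kappa> > 0 \<and> \<eta> > 0 \<and> \<nu> > 0 \<and>
     (\<forall>k. w (Suc k) \<in> ball wbar \<eta> \<and> L (w (Suc k)) < ereal (Ls + \<nu>) \<longrightarrow>
          L (w (Suc k)) - ereal Ls \<le> ereal (\<kappa> * (norm (w k - w (Suc k)))\<^sup>2))"

end

theory Submission
  imports Defs
begin

text \<open>
  Write \<open>\<Delta>x\<^sup>k = x\<^sup>k\<^sup>+\<^sup>1 - x\<^sup>k\<close> and \<open>r\<^sup>k = \<Theta> u\<^sup>k + B v\<^sup>k\<close>. Comparing \<open>u\<^sup>k\<^sup>+\<^sup>1\<close> with \<open>u\<^sup>k\<close> in the
  \<open>u\<close>-subproblem, the descent lemma and the optimality condition of the \<open>v\<close>-subproblem bound the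
  change of the augmented Lagrangian. The coupling terms
  \<open>\<gamma>/2 |\<Delta>\<Theta> + B \<Delta>v|\<^sup>2 - \<gamma> |B \<Delta>v|\<^sup>2\<close> are rewritten with
  \<open>\<gamma> (\<Delta>\<Theta> + B \<Delta>v) = \<Delta>p\<^sup>k - \<Delta>p\<^sup>k\<^sup>-\<^sup>1\<close>, so that Young's inequality leaves \<open>- \<gamma>/2 |B \<Delta>v|\<^sup>2\<close> and
  exactly the term \<open>1/(2\<gamma>) |\<Delta>p\<^sup>k\<^sup>-\<^sup>1|\<^sup>2\<close> contained in \<open>\<Lambda>\<^sup>k\<close>. As \<open>\<Delta>p\<^sup>k\<close> lies in the range of \<open>B\<close> and
  \<open>B\<^sup>T p\<^sup>k\<^sup>+\<^sup>1\<close> is minus the \<open>v\<close>-gradient plus \<open>\<gamma> B\<^sup>T \<Delta>\<Theta>\<close>, \<open>|\<Delta>p\<^sup>k|\<^sup>2\<close> is controlled by the primal steps, and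
  \<open>\<Lambda>\<^sup>k\<^sup>+\<^sup>1 + c |\<Delta>w\<^sup>k|\<^sup>2 \<le> \<Lambda>\<^sup>k\<close> for some \<open>c > 0\<close>.

  Near the accumulation point the error bound turns this into \<open>\<Lambda>\<^sup>k\<^sup>+\<^sup>1 - \<Lambda>\<^sup>* \<le> \<alpha> (\<Lambda>\<^sup>k - \<Lambda>\<^sup>*)\<close>. Once an iterate
  is close to the accumulation point with \<open>\<Lambda>\<^sup>k - \<Lambda>\<^sup>*\<close> small, the steps are dominated by a geometric
  series with sum too small to leave the ball, so the estimate persists. Passing to the limit in the
  \<open>u\<close>-subproblems, the limit minimises \<open>J + s\<close> over \<open>U\<close> for a function \<open>s\<close> differentiable at the
  limit, and a sum rule gives stationarity.
\<close>

section \<open>Gradients and Jacobians\<close>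

text \<open>First-order optimality under quadratic perturbations: at its minimiser the majorant
  \<open>a t + (|b| + 1) t^2\<close> is negative unless \<open>a = 0\<close>. The \<open>+ 1\<close>
  keeps the denominator positive when \<open>b = 0\<close>.\<close>

lemma quadratic_nonneg_imp_linear_zero:
  fixes a b :: real
  assumes "\<And>t. 0 \<le> a * t + b * t\<^sup>2"
  shows "a = 0"
proof (rule ccontr)
  assume "a \<noteq> 0"
  define t where "t = - a / (2 * (\<bar>b\<bar> + 1))"
  have "a * t + b * t\<^sup>2 \<le> a * t + (\<bar>b\<bar> + 1) * t\<^sup>2"
    by (simp add: mult_right_mono)
  also have "\<dots> = - (a\<^sup>2 / (4 * (\<bar>b\<bar> + 1)))"
  proof -
    have "a * (- a / (2 * s)) + s * (- a / (2 * s))\<^sup>2 = - (a\<^sup>2 / (4 * s))" if "0 < s" for s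
      using that by (simp add: power2_eq_square field_simps)
    from this[of "\<bar>b\<bar> + 1"] show ?thesis by (simp add: t_def)
  qed
  also have "\<dots> < 0" using \<open>a \<noteq> 0\<close> by (simp add: divide_pos_pos)
  finally show False using assms[of t] by simp
qed

text \<open>\<open>gradient\<close> is a definite description, so uniqueness comes before any
  evaluation; testing two candidates against their difference gives it.\<close>

lemma gradient_eqI:
  assumes "GDERIV f x :> D"
  shows "gradient f x = D"
proof -
  have "D' = D" if "GDERIV f x :> D'" for D'
  proof -
    have "(\<lambda>h. h \<bullet> D') = (\<lambda>h. h \<bullet> D)"
      using that assms unfolding gderiv_def by (rule has_derivative_unique)
    then have "(D' - D) \<bullet> D' = (D' - D) \<bullet> D" by metis
    then have "(D' - D) \<bullet> (D' - D) = 0" by (simp add: inner_diff_right)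
    then show ?thesis by simp
  qed
  with assms show ?thesis unfolding gradient_def by (rule the_equality)
qed

text \<open>Riesz representation: the functional \<open>f'\<close> is the inner product with
  \<open>adjoint f' 1\<close>.\<close>

lemma GDERIV_gradient:
  fixes f :: "'a::euclidean_space \<Rightarrow> real"
  assumes "f differentiable (at x)"
  shows "GDERIV f x :> gradient f x"
proof -
  obtain f' where f': "(f has_derivative f') (at x)"
    using assms by (auto simp: differentiable_def)
  then have "linear f'" using has_derivative_linear by blast
  then have "f' = (\<lambda>h. h \<bullet> adjoint f' 1)"
    using adjoint_works[of f' _ "1::real"] by fastforce
  with f' have "GDERIV f x :> adjoint f' 1"
    unfolding gderiv_def by simp
  then show ?thesis using gradient_eqI by metis
qed

lemma has_derivative_gradient:
  fixes f :: "'a::euclidean_space \<Rightarrow> real"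
  assumes "f differentiable (at x)"
  shows "(f has_derivative (\<lambda>h. gradient f x \<bullet> h)) (at x)"
  using GDERIV_gradient[OF assms] unfolding gderiv_def by (simp add: inner_commute)

lemma gradient_eqI':
  assumes "(f has_derivative (\<lambda>h. D \<bullet> h)) (at x)"
  shows "gradient f x = D"
  using assms by (intro gradient_eqI) (simp add: gderiv_def inner_commute)

lemma lipschitz_gradient_has_derivative:
  fixes f :: "'a::euclidean_space \<Rightarrow> real"
  assumes "lipschitz_gradient L f"
  shows "(f has_derivative (\<lambda>h. gradient f x \<bullet> h)) (at x)"
  using assms by (auto simp: lipschitz_gradient_def intro: has_derivative_gradient)

lemma lipschitz_gradient_bound:
  assumes "lipschitz_gradient L f"
  shows "norm (gradient f x - gradient f y) \<le> L * norm (x - y)"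
  using assms by (auto simp: lipschitz_gradient_def lipschitz_on_def dist_norm)

lemma lipschitz_gradient_nonneg: "lipschitz_gradient L f \<Longrightarrow> 0 \<le> L"
  by (auto simp: lipschitz_gradient_def lipschitz_on_def)

lemma lipschitz_gradient_tendsto:
  assumes "lipschitz_gradient L f" "(x \<longlongrightarrow> a) F"
  shows "((\<lambda>k. gradient f (x k)) \<longlongrightarrow> gradient f a) F"
proof -
  have "continuous_on UNIV (gradient f)"
    using assms(1) by (auto simp: lipschitz_gradient_def intro: lipschitz_on_continuous_on)
  then show ?thesis by (rule continuous_on_tendsto_compose[OF _ assms(2)]) auto
qed

text \<open>Along the segment from \<open>x\<close> to \<open>y\<close> the defect
  \<open>\<phi>\<close> has a nonpositive derivative, by Cauchy-Schwarz and the Lipschitz bound;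
  comparing its end points avoids integration.\<close>

lemma descent_upper:
  fixes f :: "'a::euclidean_space \<Rightarrow> real"
  assumes "lipschitz_gradient L f"
  shows "f y - f x - gradient f x \<bullet> (y - x) \<le> L / 2 * (norm (y - x))\<^sup>2"
proof -
  define \<phi> where "\<phi> t = f (x + t *\<^sub>R (y - x)) - t * (gradient f x \<bullet> (y - x))
      - L / 2 * t\<^sup>2 * (norm (y - x))\<^sup>2" for t
  have D: "(\<phi> has_real_derivative
      (gradient f (x + t *\<^sub>R (y - x)) \<bullet> (y - x) - gradient f x \<bullet> (y - x)
        - L * t * (norm (y - x))\<^sup>2)) (at t)" for t
  proof -
    have "((\<lambda>t. f (x + t *\<^sub>R (y - x))) has_derivative
        (\<lambda>h. gradient f (x + t *\<^sub>R (y - x)) \<bullet> (h *\<^sub>R (y - x)))) (at t)"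
      by (rule has_derivative_compose[OF _ lipschitz_gradient_has_derivative[OF assms]])
         (auto intro!: derivative_eq_intros)
    then have *: "((\<lambda>t. f (x + t *\<^sub>R (y - x))) has_real_derivative
        gradient f (x + t *\<^sub>R (y - x)) \<bullet> (y - x)) (at t)"
      by (rule has_derivative_imp_has_field_derivative) simp
    show ?thesis unfolding \<phi>_def
      by (auto intro!: derivative_eq_intros *)
  qed
  have "\<phi> 1 \<le> \<phi> 0"
  proof (rule DERIV_nonpos_imp_nonincreasing[where f = \<phi>])
    fix t :: real assume t: "0 \<le> t" "t \<le> 1"
    have "(gradient f (x + t *\<^sub>R (y - x)) - gradient f x) \<bullet> (y - x)
        \<le> norm (gradient f (x + t *\<^sub>R (y - x)) - gradient f x) * norm (y - x)"
      by (rule norm_cauchy_schwarz)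
    also have "\<dots> \<le> (L * norm (t *\<^sub>R (y - x))) * norm (y - x)"
      using lipschitz_gradient_bound[OF assms, of "x + t *\<^sub>R (y - x)" x]
      by (intro mult_right_mono) auto
    also have "\<dots> = L * t * (norm (y - x))\<^sup>2"
      using t by (simp add: power2_eq_square)
    finally have "gradient f (x + t *\<^sub>R (y - x)) \<bullet> (y - x) - gradient f x \<bullet> (y - x)
        - L * t * (norm (y - x))\<^sup>2 \<le> 0"
      by (simp add: inner_diff_left)
    with D show "\<exists>z. (\<phi> has_real_derivative z) (at t) \<and> z \<le> 0" by blast
  qed simp
  then show ?thesis unfolding \<phi>_def by simp
qed

lemma gradient_uminus:
  fixes f :: "'a::euclidean_space \<Rightarrow> real"
  assumes "f differentiable (at x)"
  shows "gradient (\<lambda>x. - f x) x = - gradient f x"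
  by (rule gradient_eqI') (use has_derivative_minus[OF has_derivative_gradient[OF assms]] in simp)

text \<open>The lower half is the upper half for \<open>- f\<close>. Both signs matter later,
  because the components of \<open>q\<close> have no fixed sign.\<close>

lemma descent_lemma:
  fixes f :: "'a::euclidean_space \<Rightarrow> real"
  assumes "lipschitz_gradient L f"
  shows "\<bar>f y - f x - gradient f x \<bullet> (y - x)\<bar> \<le> L / 2 * (norm (y - x))\<^sup>2"
proof -
  have d: "f differentiable (at x)" for x using assms by (simp add: lipschitz_gradient_def)
  have "lipschitz_gradient L (\<lambda>x. - f x)"
    using assms by (simp add: lipschitz_gradient_def gradient_uminus lipschitz_on_def dist_norm
        norm_minus_commute)
  from descent_upper[OF this, of y x] descent_upper[OF assms, of y x]
  show ?thesis unfolding gradient_uminus[OF d] inner_minus_left by linarith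
qed

lemma gradient_fst:
  fixes G :: "'a::euclidean_space \<times> 'b::euclidean_space \<Rightarrow> real"
  assumes "G differentiable (at (x, y))"
  shows "gradient (\<lambda>x. G (x, y)) x = fst (gradient G (x, y))"
proof (rule gradient_eqI')
  have "((\<lambda>x. G (x, y)) has_derivative (\<lambda>h. gradient G (x, y) \<bullet> (h, 0))) (at x)"
    by (rule has_derivative_compose[where g = G])
       (auto intro!: derivative_eq_intros has_derivative_gradient assms)
  then show "((\<lambda>x. G (x, y)) has_derivative (\<lambda>h. fst (gradient G (x, y)) \<bullet> h)) (at x)"
    by (simp add: inner_prod_def)
qed

lemma gradient_snd:
  fixes G :: "'a::euclidean_space \<times> 'b::euclidean_space \<Rightarrow> real"
  assumes "G differentiable (at (x, y))"
  shows "gradient (\<lambda>y. G (x, y)) y = snd (gradient G (x, y))"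
proof (rule gradient_eqI')
  have "((\<lambda>y. G (x, y)) has_derivative (\<lambda>h. gradient G (x, y) \<bullet> (0, h))) (at y)"
    by (rule has_derivative_compose[where g = G])
       (auto intro!: derivative_eq_intros has_derivative_gradient assms)
  then show "((\<lambda>y. G (x, y)) has_derivative (\<lambda>h. snd (gradient G (x, y)) \<bullet> h)) (at y)"
    by (simp add: inner_prod_def)
qed

lemma has_derivative_jacobian:
  fixes f :: "real^'n \<Rightarrow> real^'m"
  assumes "f differentiable (at x)"
  shows "(f has_derivative (\<lambda>h. jacobian f (at x) *v h)) (at x)"
  using assms by (simp add: jacobian_works[symmetric])

lemma jacobian_row:
  fixes f :: "real^'n \<Rightarrow> real^'m"
  assumes "f differentiable (at x)"
  shows "(jacobian f (at x) *v h) $ j = gradient (\<lambda>x. f x $ j) x \<bullet> h"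
proof -
  have "((\<lambda>x. f x $ j) has_derivative (\<lambda>h. (jacobian f (at x) *v h) $ j)) (at x)"
    by (rule bounded_linear.has_derivative[OF bounded_linear_vec_nth has_derivative_jacobian[OF assms]])
  moreover from this have "((\<lambda>x. f x $ j) has_derivative (\<lambda>h. gradient (\<lambda>x. f x $ j) x \<bullet> h)) (at x)"
    by (intro has_derivative_gradient) (auto simp: differentiable_def)
  ultimately show ?thesis by (metis has_derivative_unique)
qed

text \<open>The descent lemma is applied to each component, with
  \<open>\<bar>q $ j\<bar> \<le> norm q\<close>. This is the source of the term with
  \<open>norm q\<close> in the step-size rule.\<close>

lemma jacobian_linearization_error:
  fixes f :: "real^'n \<Rightarrow> real^'m"
  assumes diff: "\<And>x. f differentiable (at x)"
    and lip: "\<And>j. lipschitz_gradient (L j) (\<lambda>x. f x $ j)"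
  shows "q \<bullet> (f y - f x - jacobian f (at x) *v (y - x))
           \<le> norm q * (\<Sum>j\<in>UNIV. L j) / 2 * (norm (y - x))\<^sup>2"
proof -
  have "q \<bullet> (f y - f x - jacobian f (at x) *v (y - x))
      = (\<Sum>j\<in>UNIV. q $ j * (f y $ j - f x $ j - gradient (\<lambda>x. f x $ j) x \<bullet> (y - x)))"
    by (simp add: inner_vec_def jacobian_row[OF diff])
  also have "\<dots> \<le> (\<Sum>j\<in>UNIV. norm q * (L j / 2 * (norm (y - x))\<^sup>2))"
  proof (rule sum_mono)
    fix j
    have "q $ j * (f y $ j - f x $ j - gradient (\<lambda>x. f x $ j) x \<bullet> (y - x))
        \<le> \<bar>q $ j\<bar> * \<bar>f y $ j - f x $ j - gradient (\<lambda>x. f x $ j) x \<bullet> (y - x)\<bar>"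
      by (metis abs_ge_self abs_mult)
    also have "\<dots> \<le> norm q * (L j / 2 * (norm (y - x))\<^sup>2)"
      by (intro mult_mono descent_lemma[OF lip] component_le_norm_cart) auto
    finally show "q $ j * (f y $ j - f x $ j - gradient (\<lambda>x. f x $ j) x \<bullet> (y - x))
        \<le> norm q * (L j / 2 * (norm (y - x))\<^sup>2)" .
  qed
  also have "\<dots> = norm q * (\<Sum>j\<in>UNIV. L j) / 2 * (norm (y - x))\<^sup>2"
    by (simp add: sum_distrib_left sum_distrib_right sum_divide_distrib mult.assoc)
  finally show ?thesis .
qed

text \<open>Each row of the Jacobian is a Lipschitz gradient, so convergence can be checked row by
  row.\<close>

lemma jacobian_mult_tendsto:
  fixes f :: "real^'n \<Rightarrow> real^'m"
  assumes diff: "\<And>x. f differentiable (at x)"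
    and lip: "\<And>j. lipschitz_gradient (L j) (\<lambda>x. f x $ j)"
    and x: "(x \<longlongrightarrow> a) F" and h: "(h \<longlongrightarrow> b) F"
  shows "((\<lambda>k. jacobian f (at (x k)) *v h k) \<longlongrightarrow> jacobian f (at a) *v b) F"
proof (rule vec_tendstoI)
  show "((\<lambda>k. (jacobian f (at (x k)) *v h k) $ j) \<longlongrightarrow> (jacobian f (at a) *v b) $ j) F" for j
    unfolding jacobian_row[OF diff]
    by (rule tendsto_inner[OF lipschitz_gradient_tendsto[OF lip x] h])
qed

text \<open>The strong convexity inequality on the segment, divided by \<open>t\<close>, tends to
  the claim as \<open>t\<close> decreases to 0.\<close>

lemma bregman_ge:
  fixes K :: "'a::euclidean_space \<Rightarrow> real"
  assumes sc: "strongly_convex b K" and d: "K differentiable (at y)"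
  shows "b / 2 * (norm (x - y))\<^sup>2 \<le> bregman K x y"
proof -
  define h where "h t = K (y + t *\<^sub>R (x - y))" for t :: real
  have "((\<lambda>t. K (y + t *\<^sub>R (x - y))) has_derivative (\<lambda>s. gradient K y \<bullet> (s *\<^sub>R (x - y)))) (at 0)"
  proof (rule has_derivative_compose[of _ "\<lambda>s. s *\<^sub>R (x - y)"])
    show "(K has_derivative (\<lambda>h. gradient K y \<bullet> h)) (at (y + 0 *\<^sub>R (x - y)))"
      using has_derivative_gradient[OF d] by simp
  qed (auto intro!: derivative_eq_intros)
  then have "(h has_real_derivative gradient K y \<bullet> (x - y)) (at 0)"
    unfolding h_def by (rule has_derivative_imp_has_field_derivative) simp
  then have lim: "((\<lambda>t. (h t - h 0) / t) \<longlongrightarrow> gradient K y \<bullet> (x - y)) (at_right 0)"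
    unfolding has_field_derivative_iff by (auto intro: tendsto_mono[OF at_le])
  have lim2: "((\<lambda>t. K x - K y - b / 2 * (1 - t) * (norm (x - y))\<^sup>2) \<longlongrightarrow>
      K x - K y - b / 2 * (1 - 0) * (norm (x - y))\<^sup>2) (at_right 0)"
    by (intro tendsto_intros)
  have ev: "\<forall>\<^sub>F t in at_right 0. (h t - h 0) / t \<le> K x - K y - b / 2 * (1 - t) * (norm (x - y))\<^sup>2"
  proof -
    have "(h t - h 0) / t \<le> K x - K y - b / 2 * (1 - t) * (norm (x - y))\<^sup>2"
      if t: "0 < t" "t < 1" for t
    proof -
      have "K (t *\<^sub>R x + (1 - t) *\<^sub>R y)
          \<le> t * K x + (1 - t) * K y - b / 2 * t * (1 - t) * (norm (x - y))\<^sup>2"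
        using sc t unfolding strongly_convex_def by auto
      moreover have "t *\<^sub>R x + (1 - t) *\<^sub>R y = y + t *\<^sub>R (x - y)"
        by (simp add: algebra_simps)
      ultimately have "h t - h 0 \<le> t * (K x - K y - b / 2 * (1 - t) * (norm (x - y))\<^sup>2)"
        by (simp add: h_def algebra_simps)
      with t show ?thesis by (simp add: pos_divide_le_eq mult.commute)
    qed
    then show ?thesis
      by (auto simp: eventually_at_right_field intro!: exI[of _ 1])
  qed
  have "gradient K y \<bullet> (x - y) \<le> K x - K y - b / 2 * (1 - 0) * (norm (x - y))\<^sup>2"
    by (rule tendsto_le[OF _ lim2 lim ev]) simp
  then show ?thesis by (simp add: bregman_def)
qed

section \<open>The smallest eigenvalue of a Gram matrix\<close>

text \<open>By compactness \<open>norm (B *v x)\<close> attains its minimum on the unit sphere. The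
  minimiser is an eigenvector, and every eigenvalue is a Rayleigh quotient, hence not smaller; so
  the \<open>LEAST\<close> in \<open>lambda_min\<close> is attained. Full column rank makes it
  positive.\<close>

lemma lambda_min_gram:
  fixes B :: "real^'d^'m"
  assumes rank: "rank B = CARD('d)"
  shows "0 < lambda_min (transpose B ** B)"
    and "lambda_min (transpose B ** B) * (norm x)\<^sup>2 \<le> (norm (B *v x))\<^sup>2"
proof -
  have gram: "x \<bullet> ((transpose B ** B) *v y) = (B *v x) \<bullet> (B *v y)" for x y
    by (metis dot_lmul_matrix matrix_vector_mul_assoc vector_transpose_matrix transpose_transpose)
  have inj: "B *v x = 0 \<Longrightarrow> x = 0" for x
    using rank full_rank_injective[of B] matrix_vector_mul_linear[of B]
    by (metis injD matrix_vector_mult_0_right)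
  have "compact (sphere (0::real^'d) 1)" by simp
  moreover have "sphere (0::real^'d) 1 \<noteq> {}" by simp
  moreover have "continuous_on (sphere (0::real^'d) 1) (\<lambda>x. (norm (B *v x))\<^sup>2)"
    by (intro continuous_intros linear_continuous_on_compose matrix_vector_mult_linear_continuous_on)
  ultimately obtain z where z: "norm z = 1"
    and zmin: "\<And>x. norm x = 1 \<Longrightarrow> (norm (B *v z))\<^sup>2 \<le> (norm (B *v x))\<^sup>2"
    using continuous_attains_inf[of "sphere (0::real^'d) 1" "\<lambda>x. (norm (B *v x))\<^sup>2"] by auto
  define l where "l = (norm (B *v z))\<^sup>2"
  have ge: "l * (norm x)\<^sup>2 \<le> (norm (B *v x))\<^sup>2" for x
  proof (cases "x = 0")
    case False
    then have "l \<le> (norm (B *v (x /\<^sub>R norm x)))\<^sup>2"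
      unfolding l_def by (intro zmin) auto
    also have "\<dots> = (norm (B *v x))\<^sup>2 / (norm x)\<^sup>2"
      by (simp add: matrix_vector_mult_scaleR power_divide divide_inverse power_mult_distrib mult.commute power_inverse)
    finally show ?thesis using False by (simp add: field_simps)
  qed simp
  have "z \<noteq> 0" using z by auto
  have eig: "eigenvalue_of (transpose B ** B) l"
  proof -
    have "y \<bullet> ((transpose B ** B) *v z - l *\<^sub>R z) = 0" for y
    proof -
      \<comment> \<open>This is \<open>ge\<close> at \<open>z + t *\<^sub>R y\<close>; the constant
        term vanishes because \<open>norm z = 1\<close> and \<open>l\<close> is the value at
        \<open>z\<close>.\<close>
      have "0 \<le> (2 * (y \<bullet> ((transpose B ** B) *v z - l *\<^sub>R z))) * t
          + ((norm (B *v y))\<^sup>2 - l * (norm y)\<^sup>2) * t\<^sup>2" for t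
        using ge[of "z + t *\<^sub>R y"] z
        by (simp add: l_def gram inner_diff_right power2_norm_eq_inner matrix_vector_right_distrib
            matrix_vector_mult_scaleR inner_add_left inner_add_right inner_commute)
           (simp add: algebra_simps power2_eq_square inner_commute norm_eq_1)
      from quadratic_nonneg_imp_linear_zero[OF this] show ?thesis by simp
    qed
    then have "(transpose B ** B) *v z - l *\<^sub>R z = 0" by (metis inner_eq_zero_iff)
    then show ?thesis using \<open>z \<noteq> 0\<close> by (auto simp: eigenvalue_of_def)
  qed
  have "l \<le> m" if m: "eigenvalue_of (transpose B ** B) m" for m
  proof -
    obtain x where x: "x \<noteq> 0" "(transpose B ** B) *v x = m *\<^sub>R x"
      using m by (auto simp: eigenvalue_of_def)
    have "l * (norm x)\<^sup>2 \<le> m * (norm x)\<^sup>2"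
      using ge[of x] gram[of x x] x by (simp add: power2_norm_eq_inner)
    then show ?thesis using x by simp
  qed
  with eig have lm: "lambda_min (transpose B ** B) = l"
    unfolding lambda_min_def by (intro Least_equality) auto
  show "0 < lambda_min (transpose B ** B)"
    using inj[of z] \<open>z \<noteq> 0\<close> unfolding lm l_def by auto
  show "lambda_min (transpose B ** B) * (norm x)\<^sup>2 \<le> (norm (B *v x))\<^sup>2"
    using ge lm by simp
qed

lemma inner_matrix_mult:
  fixes B :: "real^'d^'m"
  shows "x \<bullet> (B *v y) = (transpose B *v x) \<bullet> y"
  by (metis dot_lmul_matrix transpose_matrix_vector)

text \<open>For \<open>z = B *v x\<close>, \<open>|z|^2 = (B^T z) . x \<le> |B^T z| |x|\<close>, and
  \<open>lambda_min_gram\<close> bounds \<open>|x|\<close> by \<open>|z|\<close>. The range matters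
  because \<open>transpose B\<close> can have a kernel.\<close>

lemma lambda_min_gram_range:
  fixes B :: "real^'d^'m"
  assumes rank: "rank B = CARD('d)" and z: "z \<in> range ((*v) B)"
  shows "lambda_min (transpose B ** B) * (norm z)\<^sup>2 \<le> (norm (transpose B *v z))\<^sup>2"
proof -
  obtain x where x: "z = B *v x" using z by auto
  define l where "l = lambda_min (transpose B ** B)"
  have l: "0 < l" "l * (norm x)\<^sup>2 \<le> (norm z)\<^sup>2"
    using lambda_min_gram[OF rank] by (auto simp: l_def x)
  show ?thesis
  proof (cases "z = 0")
    case False
    have "(norm z)\<^sup>2 = (transpose B *v z) \<bullet> x"
      by (metis inner_matrix_mult power2_norm_eq_inner x)
    also have "\<dots> \<le> norm (transpose B *v z) * norm x" by (rule norm_cauchy_schwarz)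
    finally have "((norm z)\<^sup>2)\<^sup>2 \<le> (norm (transpose B *v z) * norm x)\<^sup>2"
      by (intro power_mono) auto
    then have "l * ((norm z)\<^sup>2)\<^sup>2 \<le> (norm (transpose B *v z))\<^sup>2 * (l * (norm x)\<^sup>2)"
      using l by (simp add: power_mult_distrib)
    also have "\<dots> \<le> (norm (transpose B *v z))\<^sup>2 * (norm z)\<^sup>2"
      using l by (intro mult_left_mono) auto
    finally have "(l * (norm z)\<^sup>2) * (norm z)\<^sup>2 \<le> (norm (transpose B *v z))\<^sup>2 * (norm z)\<^sup>2"
      by (simp add: power2_eq_square mult_ac)
    then show ?thesis using False by (simp add: l_def)
  qed simp
qed

lemma norm_matrix_le_spectral_norm:
  fixes B :: "real^'d^'m"
  shows "norm (B *v x) \<le> spectral_norm B * norm x"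
  by (simp add: onorm)

text \<open>With \<open>y = transpose B *v z\<close>, the identity \<open>|y|^2 = z . (B y)\<close>
  moves the estimate from the transpose to \<open>B\<close>.\<close>

lemma norm_transpose_le_spectral_norm:
  fixes B :: "real^'d^'m"
  shows "norm (transpose B *v z) \<le> spectral_norm B * norm z"
proof (cases "transpose B *v z = 0")
  case False
  define y where "y = transpose B *v z"
  have "norm y * norm y = z \<bullet> (B *v y)"
    by (metis inner_matrix_mult power2_norm_eq_inner power2_eq_square y_def)
  also have "\<dots> \<le> norm z * norm (B *v y)" by (rule norm_cauchy_schwarz)
  also have "\<dots> \<le> norm z * (spectral_norm B * norm y)"
    by (intro mult_left_mono norm_matrix_le_spectral_norm) auto
  finally have "norm y * norm y \<le> (spectral_norm B * norm z) * norm y" by (simp add: mult_ac)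
  with False show ?thesis by (simp add: y_def)
qed (simp add: onorm_pos_le)

section \<open>Linear convergence from an error bound\<close>

text \<open>Values contract by \<open>\<alpha>\<close>; steps are bounded by square roots of values
  and so decay with \<open>s = sqrt \<alpha>\<close>, which is the R-linear rate. The radius is
  split in halves: one for the distance of the starting iterate \<open>w k1\<close> from
  \<open>x\<close>, one for the length of the remaining path.\<close>

lemma error_bound_linear_convergence:
  fixes w :: "nat \<Rightarrow> 'a::banach" and \<phi> :: "nat \<Rightarrow> real"
  assumes c: "0 < c" and M: "0 < M" and \<eta>: "0 < \<eta>"
    and nonneg: "\<And>k. N \<le> k \<Longrightarrow> 0 \<le> \<phi> k"
    and dec: "\<And>k. N \<le> k \<Longrightarrow> \<phi> (Suc k) + c * (norm (w k - w (Suc k)))\<^sup>2 \<le> \<phi> k"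
    and lim: "\<phi> \<longlonglongrightarrow> 0"
    and eb: "\<And>k. N \<le> k \<Longrightarrow> w (Suc k) \<in> ball x \<eta> \<Longrightarrow>
               \<phi> (Suc k) \<le> M * (norm (w k - w (Suc k)))\<^sup>2"
    and r: "strict_mono r" and acc: "(w \<circ> r) \<longlonglongrightarrow> x"
  obtains k0 \<alpha> \<rho> C where "N \<le> k0" "0 < \<alpha>" "\<alpha> < 1" "0 < \<rho>" "\<rho> < 1" "0 < C"
    and "\<And>k. k0 \<le> k \<Longrightarrow> w k \<in> ball x \<eta>"
    and "\<And>k. k0 \<le> k \<Longrightarrow> \<phi> (Suc k) \<le> \<alpha> * \<phi> k"
    and "summable (\<lambda>k. norm (w k - w (Suc k)))"
    and "w \<longlonglongrightarrow> x"
    and "\<And>k. k0 \<le> k \<Longrightarrow> norm (w k - x) \<le> C * \<rho> ^ k"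
proof -
  \<comment> \<open>Error bound and decrease give
    \<open>c * \<phi> (Suc k) \<le> M * (\<phi> k - \<phi> (Suc k))\<close>; solving for
    \<open>\<phi> (Suc k)\<close> yields this factor.\<close>
  define \<alpha> where "\<alpha> = M / (M + c)"
  define s where "s = sqrt \<alpha>"
  define a where "a k = sqrt (\<phi> k / c)" for k
  have \<alpha>: "0 < \<alpha>" "\<alpha> < 1" using c M by (auto simp: \<alpha>_def)
  then have s: "0 < s" "s < 1" by (auto simp: s_def)
  have step: "norm (w k - w (Suc k)) \<le> a k" if "N \<le> k" for k
  proof -
    have "(norm (w k - w (Suc k)))\<^sup>2 \<le> \<phi> k / c"
      using dec[OF that] nonneg[of "Suc k"] that c by (simp add: pos_le_divide_eq mult.commute)
    then show ?thesis unfolding a_def by (rule real_le_rsqrt)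
  qed
  have a0: "0 \<le> a k" if "N \<le> k" for k
    using nonneg[OF that] c by (simp add: a_def)
  have contr: "\<phi> (Suc k) \<le> \<alpha> * \<phi> k" if k: "N \<le> k" "w (Suc k) \<in> ball x \<eta>" for k
  proof -
    have "c * \<phi> (Suc k) \<le> M * (c * (norm (w k - w (Suc k)))\<^sup>2)"
      using mult_left_mono[OF eb[OF k], of c] c by (simp add: mult_ac)
    also have "\<dots> \<le> M * (\<phi> k - \<phi> (Suc k))"
      using dec[OF k(1)] M by (intro mult_left_mono) auto
    finally have "\<phi> (Suc k) * (M + c) \<le> M * \<phi> k" by (simp add: algebra_simps)
    then show ?thesis using c M by (simp add: \<alpha>_def pos_le_divide_eq)
  qed
  have acontr: "a (Suc k) \<le> s * a k" if k: "N \<le> k" "w (Suc k) \<in> ball x \<eta>" for k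
  proof -
    have "a (Suc k) \<le> sqrt (\<alpha> * (\<phi> k / c))"
      unfolding a_def using contr[OF k] c by (intro real_sqrt_le_mono) (simp add: divide_right_mono)
    then show ?thesis by (simp only: a_def s_def real_sqrt_mult)
  qed
  have "(\<lambda>k. a k / (1 - s)) \<longlonglongrightarrow> sqrt (0 / c) / (1 - s)"
    unfolding a_def using c s by (intro tendsto_intros lim) auto
  then have "(\<lambda>k. a k / (1 - s)) \<longlonglongrightarrow> 0" by simp
  from LIMSEQ_subseq_LIMSEQ[OF this r]
  have "\<forall>\<^sub>F k in sequentially. a (r k) / (1 - s) < \<eta> / 2"
    using \<eta> by (intro order_tendstoD(2)[of _ 0]) (auto simp: o_def)
  moreover have "\<forall>\<^sub>F k in sequentially. dist (w (r k)) x < \<eta> / 2"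
    using tendstoD[OF acc, of "\<eta> / 2"] \<eta> by simp
  moreover have "\<forall>\<^sub>F k in sequentially. N \<le> r k"
    using filterlim_subseq[OF r] by (simp add: filterlim_at_top)
  ultimately have "\<forall>\<^sub>F k in sequentially.
      a (r k) / (1 - s) < \<eta> / 2 \<and> dist (w (r k)) x < \<eta> / 2 \<and> N \<le> r k"
    by eventually_elim simp
  then obtain k1 where k1: "a k1 / (1 - s) < \<eta> / 2" "dist (w k1) x < \<eta> / 2" "N \<le> k1"
    by (auto simp: eventually_sequentially)
  have geom: "(\<Sum>j<n. s ^ j) \<le> 1 / (1 - s)" for n
  proof -
    have "(\<Sum>j<n. s ^ j) = (1 - s ^ n) / (1 - s)" using s by (simp add: sum_gp_strict)
    also have "\<dots> \<le> 1 / (1 - s)" using s by (intro divide_right_mono) auto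
    finally show ?thesis .
  qed
  \<comment> \<open>The three claims need a joint induction: the path length puts the next iterate
    into the ball, and only then does the contraction apply to it.\<close>
  have main: "norm (w (k1 + n) - w k1) \<le> a k1 * (\<Sum>j<n. s ^ j) \<and> a (k1 + n) \<le> s ^ n * a k1
      \<and> w (k1 + n) \<in> ball x \<eta>" for n
  proof (induction n)
    case 0
    show ?case using k1 \<eta> by (simp add: dist_commute)
  next
    case (Suc n)
    have "norm (w (k1 + Suc n) - w k1)
        \<le> norm (w (k1 + n) - w k1) + norm (w (k1 + n) - w (Suc (k1 + n)))"
      using norm_triangle_ineq4[of "w (k1 + n) - w k1" "w (k1 + n) - w (Suc (k1 + n))"] by simp
    also have "\<dots> \<le> a k1 * (\<Sum>j<n. s ^ j) + s ^ n * a k1"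
      using Suc step[of "k1 + n"] k1 by (intro add_mono) (auto intro: order_trans)
    finally have 1: "norm (w (k1 + Suc n) - w k1) \<le> a k1 * (\<Sum>j<Suc n. s ^ j)"
      by (simp add: algebra_simps)
    also have "\<dots> \<le> a k1 * (1 / (1 - s))" using k1 a0 by (intro mult_left_mono geom) auto
    also have "\<dots> < \<eta> / 2" using k1(1) by simp
    finally have "dist (w (k1 + Suc n)) (w k1) < \<eta> / 2" by (simp only: dist_norm)
    with k1(2) have "dist x (w (k1 + Suc n)) < \<eta>"
      using dist_triangle2[of x "w (k1 + Suc n)" "w k1"] dist_commute[of x "w k1"] by linarith
    then have 2: "w (k1 + Suc n) \<in> ball x \<eta>" by simp
    then have "a (k1 + Suc n) \<le> s * a (k1 + n)" using acontr[of "k1 + n"] k1 by simp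
    also have "\<dots> \<le> s * (s ^ n * a k1)" using Suc s by (intro mult_left_mono) auto
    finally show ?case using 1 2 by (simp add: mult.assoc)
  qed
  have d: "norm (w (k1 + n) - w (Suc (k1 + n))) \<le> a k1 * s ^ n" for n
    using step[of "k1 + n"] main[of n] k1 by (auto simp: mult.commute)
  have sum: "summable (\<lambda>k. norm (w k - w (Suc k)))"
  proof -
    have "summable (\<lambda>n. norm (w (n + k1) - w (Suc (n + k1))))"
    proof (rule summable_comparison_test')
      show "summable (\<lambda>n. a k1 * s ^ n)" using s by (intro summable_mult summable_geometric) auto
      show "norm (norm (w (n + k1) - w (Suc (n + k1)))) \<le> a k1 * s ^ n" for n
        using d[of n] by (simp add: add.commute)
    qed
    then show ?thesis by (subst (asm) summable_iff_shift)
  qed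
  have wx: "w \<longlonglongrightarrow> x"
  proof -
    have "summable (\<lambda>k. w (Suc k) - w k)"
      by (rule summable_norm_cancel) (use sum in \<open>simp add: norm_minus_commute\<close>)
    then obtain l where "(\<lambda>n. \<Sum>k<n. w (Suc k) - w k) \<longlonglongrightarrow> l"
      by (auto simp: summable_def sums_def)
    then have "(\<lambda>n. w n - w 0 + w 0) \<longlonglongrightarrow> l + w 0"
      by (intro tendsto_add tendsto_const) (simp add: sum_lessThan_telescope)
    then have l: "w \<longlonglongrightarrow> l + w 0" by simp
    from LIMSEQ_unique[OF LIMSEQ_subseq_LIMSEQ[OF l r] acc] l show ?thesis by simp
  qed
  have tail: "norm (w (k1 + n) - x) \<le> (a k1 / (1 - s)) * s ^ n" for n
  proof -
    have part: "norm (w (k1 + n) - w (k1 + n + m)) \<le> a k1 * s ^ n * (\<Sum>j<m. s ^ j)" for m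
    proof (induction m)
      case (Suc m)
      have "norm (w (k1 + n) - w (k1 + n + Suc m))
          \<le> norm (w (k1 + n) - w (k1 + n + m)) + norm (w (k1 + n + m) - w (Suc (k1 + n + m)))"
        using norm_triangle_ineq[of "w (k1 + n) - w (k1 + n + m)"
            "w (k1 + n + m) - w (Suc (k1 + n + m))"] by simp
      also have "\<dots> \<le> a k1 * s ^ n * (\<Sum>j<m. s ^ j) + a k1 * s ^ (n + m)"
        using d[of "n + m"] Suc by (simp add: add.assoc)
      finally show ?case by (simp add: algebra_simps power_add)
    qed simp
    have bd: "norm (w (k1 + n) - w (k1 + n + m)) \<le> (a k1 / (1 - s)) * s ^ n" for m
    proof -
      have "a k1 * s ^ n * (\<Sum>j<m. s ^ j) \<le> a k1 * s ^ n * (1 / (1 - s))"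
        using k1 a0 s by (intro mult_left_mono geom) auto
      with part[of m] show ?thesis by simp
    qed
    have "(\<lambda>m. w (m + (k1 + n))) \<longlonglongrightarrow> x" by (rule LIMSEQ_ignore_initial_segment[OF wx])
    then have "(\<lambda>m. norm (w (k1 + n) - w (k1 + n + m))) \<longlonglongrightarrow> norm (w (k1 + n) - x)"
      by (intro tendsto_intros) (simp add: add.commute)
    then show ?thesis by (rule LIMSEQ_le_const2) (use bd in auto)
  qed
  \<comment> \<open>Dividing by \<open>s ^ k1\<close> turns the exponent \<open>k - k1\<close> into
    \<open>k\<close>; the \<open>+ 1\<close> keeps \<open>C\<close> positive when
    \<open>a k1 = 0\<close>.\<close>
  define C where "C = (a k1 / (1 - s)) / s ^ k1 + 1"
  have C: "0 < C" using a0[OF k1(3)] s by (simp add: C_def add_nonneg_pos)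
  show ?thesis
  proof
    show "N \<le> k1" "0 < \<alpha>" "\<alpha> < 1" "0 < s" "s < 1" "0 < C" by fact+
    show "w k \<in> ball x \<eta>" if "k1 \<le> k" for k
      using main[of "k - k1"] that by simp
    then show "\<phi> (Suc k) \<le> \<alpha> * \<phi> k" if "k1 \<le> k" for k
      using contr[of k] that k1(3) by (meson le_SucI order_trans)
    show "summable (\<lambda>k. norm (w k - w (Suc k)))" "w \<longlonglongrightarrow> x" by fact+
    show "norm (w k - x) \<le> C * s ^ k" if "k1 \<le> k" for k
    proof -
      have "norm (w k - x) \<le> (a k1 / (1 - s)) * s ^ (k - k1)" using tail[of "k - k1"] that by simp
      also have "\<dots> = (a k1 / (1 - s)) / s ^ k1 * s ^ k"
        using s that by (simp add: power_diff)
      also have "\<dots> \<le> C * s ^ k" using s by (intro mult_right_mono) (auto simp: C_def)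
      finally show ?thesis .
    qed
  qed
qed

section \<open>A sum rule for limiting subdifferentials\<close>

text \<open>Up to a constant, \<open>g\<close> is a minorant touching \<open>f\<close> at
  \<open>x\<close>, so the difference quotients of \<open>f\<close> lie above those of
  \<open>g\<close>, which tend to 0.\<close>

lemma frechet_subdiffI:
  fixes f :: "'a::euclidean_space \<Rightarrow> ereal"
  assumes fin: "\<bar>f x\<bar> \<noteq> \<infinity>"
    and d: "(g has_derivative (\<lambda>h. \<xi> \<bullet> h)) (at x)"
    and le: "\<forall>\<^sub>F y in at x. f x + ereal (g y - g x) \<le> f y"
  shows "\<xi> \<in> frechet_subdiff f x"
proof -
  obtain fx where fx: "f x = ereal fx" using fin by auto
  have "((\<lambda>y. norm (g y - g x - \<xi> \<bullet> (y - x)) / norm (y - x)) \<longlongrightarrow> 0) (at x)"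
    using d by (simp add: has_derivative_iff_norm)
  then have "((\<lambda>y. norm ((g y - g x - \<xi> \<bullet> (y - x)) / norm (y - x))) \<longlongrightarrow> 0) (at x)"
    by simp
  then have "((\<lambda>y. (g y - g x - \<xi> \<bullet> (y - x)) / norm (y - x)) \<longlongrightarrow> 0) (at x)"
    by (rule tendsto_norm_zero_cancel)
  then have "((\<lambda>y. ereal ((g y - g x - \<xi> \<bullet> (y - x)) / norm (y - x))) \<longlongrightarrow> 0) (at x)"
    by (simp add: zero_ereal_def)
  then have "0 = Liminf (at x) (\<lambda>y. ereal ((g y - g x - \<xi> \<bullet> (y - x)) / norm (y - x)))"
    by (intro lim_imp_Liminf[symmetric]) auto
  also have "\<dots> \<le> Liminf (at x) (\<lambda>y. (f y - f x - ereal (\<xi> \<bullet> (y - x))) / ereal (norm (y - x)))"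
  proof (rule Liminf_mono)
    have "\<forall>\<^sub>F y in at x. y \<noteq> x" by (simp add: eventually_at_filter)
    with le show "\<forall>\<^sub>F y in at x. ereal ((g y - g x - \<xi> \<bullet> (y - x)) / norm (y - x))
        \<le> (f y - f x - ereal (\<xi> \<bullet> (y - x))) / ereal (norm (y - x))"
    proof eventually_elim
      case (elim y)
      then have "0 < norm (y - x)" by auto
      with elim show ?case by (cases "f y") (auto simp: fx divide_right_mono)
    qed
  qed
  finally show ?thesis using fin by (simp add: frechet_subdiff_def)
qed

lemma frechet_subdiff_subset_limiting: "frechet_subdiff f x \<subseteq> limiting_subdiff f x"
proof
  fix \<xi> assume "\<xi> \<in> frechet_subdiff f x"
  then show "\<xi> \<in> limiting_subdiff f x"
    unfolding limiting_subdiff_def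
    by (intro CollectI conjI exI[of _ "\<lambda>_. x"] exI[of _ "\<lambda>_. \<xi>"])
       (auto simp: frechet_subdiff_def)
qed

text \<open>Decoupling by a quadratic penalty: minimising \<open>J a + g \<bullet> (a - x) + k/2 |a - b|\<^sup>2\<close> over a
  free point \<open>a\<close> and a constrained point \<open>b\<close> splits the optimality condition at \<open>x\<close> into a
  Frechet subgradient at \<open>a\<close> and a normal vector at \<open>b\<close>. The term \<open>4 \<epsilon> / r |a - x|\<^sup>2\<close> keeps both
  points in the interior of the ball of radius \<open>r\<close>.\<close>

lemma approximate_sum_rule:
  fixes J :: "'a::euclidean_space \<Rightarrow> ereal"
  assumes U: "closed U" "convex U" "x \<in> U"
    and R: "0 < R" and fin: "\<And>y. y \<in> ball x R \<Longrightarrow> \<bar>J y\<bar> \<noteq> \<infinity>"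
    and lip: "L-lipschitz_on (ball x R) (\<lambda>y. real_of_ereal (J y))"
    and s: "(s has_derivative (\<lambda>h. g \<bullet> h)) (at x)"
    and min: "\<And>y. y \<in> U \<Longrightarrow> J x + ereal (s x) \<le> J y + ereal (s y)"
    and \<epsilon>: "0 < \<epsilon>" "\<epsilon> \<le> 1"
  shows "\<exists>a b \<zeta> e. a \<in> ball x R \<and> norm (a - x) \<le> \<epsilon> \<and> norm (b - x) \<le> \<epsilon> \<and> \<zeta> \<in> normal_cone U b
      \<and> norm \<zeta> \<le> 2 * (L + norm g + 8) \<and> norm e \<le> 6 * \<epsilon> \<and> - (g + e + \<zeta>) \<in> frechet_subdiff J a"
proof -
  define j where "j y = real_of_ereal (J y)" for y
  have J: "J y = ereal (j y)" if "y \<in> ball x R" for y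
    using fin[OF that] by (simp add: j_def ereal_real)
  have L0: "0 \<le> L" using lip by (rule lipschitz_on_nonneg)
  obtain d where d: "0 < d"
    "\<And>y. norm (y - x) < d \<Longrightarrow> norm (s y - s x - g \<bullet> (y - x)) \<le> \<epsilon> * norm (y - x)"
    using s \<epsilon> unfolding has_derivative_at_alt by blast
  \<comment> \<open>Below \<open>d\<close> the expansion of \<open>s\<close> is accurate, below
    \<open>R\<close> the function \<open>J\<close> is Lipschitz, and \<open>\<epsilon>\<close>
    bounds the distances in the conclusion.\<close>
  define r where "r = Min {d / 2, R / 2, \<epsilon>}"
  have r: "0 < r" "r < d" "r < R" "r \<le> \<epsilon>" using d R \<epsilon> by (auto simp: r_def min_def)
  have cR: "cball x r \<subseteq> ball x R" using r by auto
  define \<psi> where "\<psi> y = j y + g \<bullet> (y - x) + (4 * \<epsilon> / r) * (norm (y - x))\<^sup>2" for y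
  \<comment> \<open>A Lipschitz constant of \<open>\<psi>\<close> on the closed ball; the quadratic
    term contributes \<open>8 * \<epsilon>\<close> because both points are within \<open>r\<close>
    of \<open>x\<close>.\<close>
  define L' where "L' = L + norm g + 8 * \<epsilon>"
  have L': "0 < L'" using L0 \<epsilon> by (simp add: L'_def add_nonneg_pos)
  have \<psi>_lip: "\<psi> y - \<psi> z \<le> L' * norm (y - z)" if yz: "y \<in> cball x r" "z \<in> cball x r" for y z
  proof -
    have "j y - j z \<le> L * norm (y - z)"
      using lipschitz_onD[OF lip, of y z] subsetD[OF cR yz(1)] subsetD[OF cR yz(2)]
      by (simp add: j_def dist_norm)
    moreover have "g \<bullet> (y - x) - g \<bullet> (z - x) \<le> norm g * norm (y - z)"
      using norm_cauchy_schwarz[of g "y - z"] by (simp add: inner_diff_right)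
    moreover have "(4 * \<epsilon> / r) * (norm (y - x))\<^sup>2 - (4 * \<epsilon> / r) * (norm (z - x))\<^sup>2
        \<le> 8 * \<epsilon> * norm (y - z)"
    proof -
      have "(norm (y - x))\<^sup>2 - (norm (z - x))\<^sup>2
          = (norm (y - x) + norm (z - x)) * (norm (y - x) - norm (z - x))"
        by (simp add: power2_eq_square algebra_simps)
      also have "\<dots> \<le> (norm (y - x) + norm (z - x)) * norm (y - z)"
        using norm_triangle_ineq2[of "y - x" "z - x"] by (intro mult_left_mono) auto
      also have "\<dots> \<le> (2 * r) * norm (y - z)"
        using yz by (intro mult_right_mono) (auto simp: dist_norm norm_minus_commute)
      finally have "(4 * \<epsilon> / r) * ((norm (y - x))\<^sup>2 - (norm (z - x))\<^sup>2)
          \<le> (4 * \<epsilon> / r) * ((2 * r) * norm (y - z))"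
        using \<epsilon> r by (intro mult_left_mono) auto
      also have "\<dots> = 8 * \<epsilon> * norm (y - z)" using r by simp
      finally show ?thesis by (simp add: right_diff_distrib)
    qed
    ultimately show ?thesis by (simp add: \<psi>_def L'_def distrib_right)
  qed
  \<comment> \<open>Replacing \<open>s\<close> by its linearisation costs only
    \<open>\<epsilon> * norm (y - x)\<close>, so \<open>x\<close> nearly minimises the linearised
    objective on \<open>U\<close>.\<close>
  have low: "j x - \<epsilon> * norm (y - x) + (4 * \<epsilon> / r) * (norm (y - x))\<^sup>2 \<le> \<psi> y"
    if y: "y \<in> U" "y \<in> cball x r" for y
  proof -
    have "j x + s x \<le> j y + s y"
      using min[OF y(1)] J[of x] J[of y] R y cR by auto
    moreover have "norm (y - x) < d" using y r by (simp add: dist_norm norm_minus_commute)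
    note d(2)[OF this]
    ultimately show ?thesis by (simp add: \<psi>_def abs_le_iff)
  qed
  \<comment> \<open>The first summand forces \<open>norm (a - b) < r / 4\<close>, the second
    contradicts \<open>norm (b - x) \<ge> r / 2\<close>, and the \<open>+ 1\<close> makes both
    comparisons strict.\<close>
  define k where "k = 8 * L' / r + L'\<^sup>2 / (\<epsilon> * r) + 1"
  have k: "0 < k" "8 * L' / r < k" "L'\<^sup>2 / (\<epsilon> * r) < k"
    using L' r \<epsilon> by (auto simp: k_def add_nonneg_pos add_pos_nonneg)
  define S where "S = cball x r \<times> (U \<inter> cball x r)"
  have "compact S" using U by (simp add: S_def compact_Times closed_Int_compact)
  moreover have xS: "(x, x) \<in> S" using U r by (simp add: S_def)
  moreover have "continuous_on S (\<lambda>(a, b). \<psi> a + k / 2 * (norm (a - b))\<^sup>2)"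
  proof -
    have "continuous_on (cball x r) \<psi>"
    proof -
      have "continuous_on (cball x r) j"
        using lipschitz_on_continuous_on[OF lip] cR continuous_on_subset by (auto simp: j_def[abs_def])
      then show ?thesis unfolding \<psi>_def by (intro continuous_intros)
    qed
    then have "continuous_on S (\<lambda>z. \<psi> (fst z))"
      by (rule continuous_on_compose2) (auto simp: S_def intro: continuous_intros)
    then show ?thesis unfolding case_prod_beta by (intro continuous_intros)
  qed
  ultimately obtain a b where ab: "(a, b) \<in> S"
    and opt: "\<And>a' b'. (a', b') \<in> S \<Longrightarrow>
      \<psi> a + k / 2 * (norm (a - b))\<^sup>2 \<le> \<psi> a' + k / 2 * (norm (a' - b'))\<^sup>2"
    using continuous_attains_inf[of S "\<lambda>(a, b). \<psi> a + k / 2 * (norm (a - b))\<^sup>2"]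
    by (fastforce)
  have a: "a \<in> cball x r" and b: "b \<in> U" "b \<in> cball x r" using ab by (auto simp: S_def)
  have kd: "k * norm (a - b) \<le> 2 * L'"
  proof (cases "a = b")
    case False
    have "k / 2 * (norm (a - b))\<^sup>2 \<le> \<psi> b - \<psi> a" using opt[of b b] b by (simp add: S_def)
    also have "\<dots> \<le> L' * norm (a - b)" using \<psi>_lip[OF b(2) a] by (simp add: norm_minus_commute)
    finally have "(k * norm (a - b)) * norm (a - b) \<le> (2 * L') * norm (a - b)"
      by (simp add: power2_eq_square)
    then show ?thesis using False by simp
  qed (use L' in auto)
  have dist_ab: "norm (a - b) < r / 4"
  proof -
    have "8 * L' < k * r" using k(2) r by (simp add: pos_divide_less_eq)
    then have "k * norm (a - b) < k * (r / 4)" using kd by simp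
    then show ?thesis using k(1) by simp
  qed
  \<comment> \<open>If \<open>b\<close> were this far out, the growth term would raise
    \<open>\<psi>\<close> by at least \<open>\<epsilon> * r / 2\<close>, while the gain from
    separating \<open>a\<close> and \<open>b\<close> is at most \<open>L'\<^sup>2 / (2 * k)\<close>,
    the maximum of a quadratic in \<open>norm (a - b)\<close>.\<close>
  have dist_b: "norm (b - x) < r / 2"
  proof (rule ccontr)
    assume neg: "\<not> norm (b - x) < r / 2"
    define t where "t = norm (b - x)"
    have t: "r / 2 \<le> t" using neg by (simp add: t_def)
    have "j x - \<epsilon> * t + (4 * \<epsilon> / r) * t\<^sup>2 \<le> \<psi> b" using low[OF b] by (simp add: t_def)
    also have "\<dots> \<le> \<psi> a + L' * norm (a - b)"
      using \<psi>_lip[OF b(2) a] by (simp add: norm_minus_commute)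
    also have "\<psi> a \<le> j x - k / 2 * (norm (a - b))\<^sup>2"
      using opt[OF xS] by (simp add: \<psi>_def)
    finally have 1: "(4 * \<epsilon> / r) * t\<^sup>2 - \<epsilon> * t \<le> L' * norm (a - b) - k / 2 * (norm (a - b))\<^sup>2"
      by simp
    have "0 \<le> (L' - k * norm (a - b))\<^sup>2" by simp
    then have "2 * k * (L' * norm (a - b) - k / 2 * (norm (a - b))\<^sup>2) \<le> L'\<^sup>2"
      by (simp add: power2_eq_square algebra_simps)
    then have 2: "2 * k * ((4 * \<epsilon> / r) * t\<^sup>2 - \<epsilon> * t) \<le> L'\<^sup>2"
      using mult_left_mono[OF 1, of "2 * k"] k(1) by linarith
    have "\<epsilon> * t \<le> (2 * \<epsilon> / r) * t\<^sup>2"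
      using mult_right_mono[OF t, of "2 * \<epsilon> / r * t"] t r \<epsilon> by (simp add: power2_eq_square mult_ac)
    moreover have "\<epsilon> * r / 2 \<le> \<epsilon> * t" using t \<epsilon> by simp
    ultimately have "\<epsilon> * r / 2 \<le> (4 * \<epsilon> / r) * t\<^sup>2 - \<epsilon> * t" by simp
    then have "2 * k * (\<epsilon> * r / 2) \<le> L'\<^sup>2" using 2 k(1)
      mult_left_mono[of "\<epsilon> * r / 2" "(4 * \<epsilon> / r) * t\<^sup>2 - \<epsilon> * t" "2 * k"] by linarith
    moreover have "L'\<^sup>2 < k * (\<epsilon> * r)" using k(3) \<epsilon> r by (simp add: pos_divide_less_eq)
    ultimately show False by simp
  qed
  have dist_a: "norm (a - x) < 3 / 4 * r"
    using norm_triangle_ineq[of "a - b" "b - x"] dist_ab dist_b by simp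
  define \<zeta> where "\<zeta> = k *\<^sub>R (a - b)"
  define e where "e = (8 * \<epsilon> / r) *\<^sub>R (a - x)"
  \<comment> \<open>For fixed \<open>a\<close>, the point \<open>b\<close> is the projection of
    \<open>a\<close> onto \<open>U \<inter> cball x r\<close>. As \<open>b\<close> is interior to
    the ball, a short move towards any \<open>z\<close> in \<open>U\<close> stays
    admissible.\<close>
  have normal: "\<zeta> \<in> normal_cone U b"
    unfolding normal_cone_def
  proof safe
    fix z assume z: "z \<in> U"
    define t where "t = min 1 (r / (2 * (norm (z - b) + 1)))"
    have t: "0 < t" "t \<le> 1" using r by (auto simp: t_def add_nonneg_pos)
    have "t * norm (z - b) \<le> r / (2 * (norm (z - b) + 1)) * norm (z - b)"
      by (intro mult_right_mono) (auto simp: t_def)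
    also have "\<dots> \<le> r / 2"
    proof -
      have "norm (z - b) / (norm (z - b) + 1) \<le> 1" by (simp add: divide_le_eq add_nonneg_pos)
      from mult_left_mono[OF this, of "r / 2"] r show ?thesis by simp
    qed
    finally have tz: "norm (t *\<^sub>R (z - b)) \<le> r / 2" using t by simp
    define y where "y = b + t *\<^sub>R (z - b)"
    have "y = (1 - t) *\<^sub>R b + t *\<^sub>R z" by (simp add: y_def algebra_simps)
    then have "y \<in> U" using convexD_alt[OF U(2) b(1) z, of t] t by simp
    moreover have "y \<in> cball x r"
      using norm_triangle_ineq[of "b - x" "t *\<^sub>R (z - b)"] tz dist_b
      by (simp add: y_def dist_norm norm_minus_commute algebra_simps)
    ultimately have yS: "y \<in> U \<inter> cball x r" by simp
    have closest: "\<forall>w\<in>U \<inter> cball x r. dist a b \<le> dist a w"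
    proof
      fix w assume "w \<in> U \<inter> cball x r"
      then have "k / 2 * (norm (a - b))\<^sup>2 \<le> k / 2 * (norm (a - w))\<^sup>2"
        using opt[of a w] a by (simp add: S_def)
      then have "(norm (a - b))\<^sup>2 \<le> (norm (a - w))\<^sup>2" using k(1) by simp
      then show "dist a b \<le> dist a w" by (simp add: dist_norm power2_le_iff_abs_le)
    qed
    have "(a - b) \<bullet> (y - b) \<le> 0"
      by (rule any_closest_point_dot[OF _ _ _ yS closest]) (use U b in \<open>auto intro: convex_Int\<close>)
    then have "t * ((a - b) \<bullet> (z - b)) \<le> 0" by (simp add: y_def)
    then have "(a - b) \<bullet> (z - b) \<le> 0" using t by (simp add: mult_le_0_iff)
    then show "\<zeta> \<bullet> (z - b) \<le> 0" using k(1) by (simp add: \<zeta>_def mult_le_0_iff)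
  qed
  have sub: "- (g + e + \<zeta>) \<in> frechet_subdiff J a"
  proof (rule frechet_subdiffI)
    have aR: "a \<in> ball x R" using a r by simp
    show "\<bar>J a\<bar> \<noteq> \<infinity>" by (rule fin[OF aR])
    \<comment> \<open>For fixed \<open>b\<close>, optimality of \<open>a\<close> says that
      \<open>q\<close>, up to a constant, is a smooth local minorant of \<open>J\<close> touching at
      \<open>a\<close>.\<close>
    define q where "q y = - (g \<bullet> (y - x) + (4 * \<epsilon> / r) * ((y - x) \<bullet> (y - x))
        + k / 2 * ((y - b) \<bullet> (y - b)))" for y
    show "(q has_derivative (\<lambda>h. - (g + e + \<zeta>) \<bullet> h)) (at a)"
      unfolding q_def
      by (rule derivative_eq_intros refl | simp)+
         (auto simp: fun_eq_iff e_def \<zeta>_def inner_add_left inner_commute algebra_simps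
           add_divide_distrib diff_divide_distrib)
    have "a \<in> ball x r" using dist_a r by (simp add: dist_norm norm_minus_commute)
    then have "\<forall>\<^sub>F y in at a. y \<in> ball x r"
      by (intro eventually_at_in_open') auto
    then show "\<forall>\<^sub>F y in at a. J a + ereal (q y - q a) \<le> J y"
    proof eventually_elim
      case (elim y)
      then have "(y, b) \<in> S" using b by (auto simp: S_def)
      from opt[OF this] have "j a + (q y - q a) \<le> j y"
        by (simp add: \<psi>_def q_def power2_norm_eq_inner)
      moreover have "y \<in> ball x R" using elim r by simp
      ultimately show ?case using J[OF aR] J[of y] by simp
    qed
  qed
  have "norm e \<le> 6 * \<epsilon>"
  proof -
    have "norm e \<le> (8 * \<epsilon> / r) * (3 / 4 * r)"
      using \<epsilon> r dist_a unfolding e_def norm_scaleR by (intro mult_mono) auto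
    then show ?thesis using r by simp
  qed
  moreover have "norm \<zeta> \<le> 2 * (L + norm g + 8)"
    using kd k(1) \<epsilon> by (simp add: \<zeta>_def L'_def)
  moreover have "a \<in> ball x R" using a r by simp
  moreover have "norm (a - x) \<le> \<epsilon>" "norm (b - x) \<le> \<epsilon>" using dist_a dist_b r by auto
  ultimately show ?thesis using normal sub by blast
qed

text \<open>The approximate rule is used with tolerances tending to 0. The Lipschitz constant bounds
  the normal vectors uniformly, so a subsequence converges; the graph of the normal cone is closed,
  and continuity of \<open>J\<close> near \<open>x\<close> gives the convergence of values required
  by the limiting subdifferential.\<close>

lemma constrained_minimizer_lipschitz:
  fixes J :: "'a::euclidean_space \<Rightarrow> ereal"
  assumes U: "closed U" "convex U" "x \<in> U"
    and lip: "lipschitz_around J x"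
    and s: "(s has_derivative (\<lambda>h. g \<bullet> h)) (at x)"
    and min: "\<And>y. y \<in> U \<Longrightarrow> J x + ereal (s x) \<le> J y + ereal (s y)"
  shows "\<exists>\<xi>\<in>limiting_subdiff J x. \<exists>\<zeta>\<in>normal_cone U x. g + \<xi> + \<zeta> = 0"
proof -
  obtain R L where R: "0 < R" and fin': "\<forall>y\<in>ball x R. \<bar>J y\<bar> \<noteq> \<infinity>"
    and L: "L-lipschitz_on (ball x R) (\<lambda>y. real_of_ereal (J y))"
    using lip unfolding lipschitz_around_def by (elim exE conjE)
  have fin: "\<bar>J y\<bar> \<noteq> \<infinity>" if "y \<in> ball x R" for y
    using fin' that by (rule bspec)
  define \<epsilon> where "\<epsilon> n = 1 / real (Suc n)" for n
  have \<epsilon>: "0 < \<epsilon> n" "\<epsilon> n \<le> 1" for n by (auto simp: \<epsilon>_def)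
  have \<epsilon>0: "\<epsilon> \<longlonglongrightarrow> 0"
    unfolding \<epsilon>_def using LIMSEQ_inverse_real_of_nat by (simp add: inverse_eq_divide)
  define C where "C = 2 * (L + norm g + 8)"
  define P where "P n a b \<zeta> e \<longleftrightarrow> a \<in> ball x R \<and> norm (a - x) \<le> \<epsilon> n \<and> norm (b - x) \<le> \<epsilon> n
      \<and> \<zeta> \<in> normal_cone U b \<and> norm \<zeta> \<le> C \<and> norm e \<le> 6 * \<epsilon> n
      \<and> - (g + e + \<zeta>) \<in> frechet_subdiff J a" for n a b \<zeta> e
  have "\<exists>a b \<zeta> e. P n a b \<zeta> e" for n
    unfolding P_def C_def by (rule approximate_sum_rule[OF U R fin L s min \<epsilon>])
  then obtain a b \<zeta> e where P: "\<And>n. P n (a n) (b n) (\<zeta> n) (e n)" by metis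
  then have a: "\<And>n. a n \<in> ball x R" and ax: "\<And>n. norm (a n - x) \<le> \<epsilon> n"
    and bx: "\<And>n. norm (b n - x) \<le> \<epsilon> n" and \<zeta>: "\<And>n. \<zeta> n \<in> normal_cone U (b n)"
    and \<zeta>_bd: "\<And>n. norm (\<zeta> n) \<le> C"
    and e: "\<And>n. norm (e n) \<le> 6 * \<epsilon> n"
    and sub: "\<And>n. - (g + e n + \<zeta> n) \<in> frechet_subdiff J (a n)"
    by (simp_all add: P_def)
  have "\<forall>n. \<zeta> n \<in> cball 0 C" using \<zeta>_bd by simp
  moreover have "compact (cball (0::'a) C)" by simp
  ultimately obtain l f where f: "strict_mono f" "(\<zeta> \<circ> f) \<longlonglongrightarrow> l"
    unfolding compact_def by blast
  have \<epsilon>f: "(\<lambda>n. \<epsilon> (f n)) \<longlonglongrightarrow> 0" using LIMSEQ_subseq_LIMSEQ[OF \<epsilon>0 f(1)] by (simp add: o_def)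
  have af: "(\<lambda>n. a (f n)) \<longlonglongrightarrow> x"
    by (rule LIM_zero_cancel, rule Lim_null_comparison[OF _ \<epsilon>f]) (use ax in auto)
  have bf: "(\<lambda>n. b (f n)) \<longlonglongrightarrow> x"
    by (rule LIM_zero_cancel, rule Lim_null_comparison[OF _ \<epsilon>f]) (use bx in auto)
  have "(\<lambda>n. 6 * \<epsilon> (f n)) \<longlonglongrightarrow> 6 * 0" by (intro tendsto_intros \<epsilon>f)
  then have ef: "(\<lambda>n. e (f n)) \<longlonglongrightarrow> 0"
    by (intro Lim_null_comparison[of "\<lambda>n. e (f n)" "\<lambda>n. 6 * \<epsilon> (f n)"]) (use e in auto)
  have "l \<in> normal_cone U x"
    unfolding normal_cone_def
  proof safe
    fix z assume "z \<in> U"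
    then have "\<zeta> (f n) \<bullet> (z - b (f n)) \<le> 0" for n using \<zeta> by (auto simp: normal_cone_def)
    moreover have "(\<lambda>n. \<zeta> (f n) \<bullet> (z - b (f n))) \<longlonglongrightarrow> l \<bullet> (z - x)"
      using f(2) by (intro tendsto_intros bf) (simp add: o_def)
    ultimately show "l \<bullet> (z - x) \<le> 0" by (intro LIMSEQ_le_const2) auto
  qed
  moreover have "- (g + l) \<in> limiting_subdiff J x"
    unfolding limiting_subdiff_def
  proof (intro CollectI conjI exI)
    have J: "J y = ereal (real_of_ereal (J y))" if "y \<in> ball x R" for y
      using fin[OF that] by (simp add: ereal_real)
    show "\<bar>J x\<bar> \<noteq> \<infinity>" using R by (intro fin) auto
    show "(\<lambda>n. a (f n)) \<longlonglongrightarrow> x" by fact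
    have "(\<lambda>n. real_of_ereal (J (a (f n)))) \<longlonglongrightarrow> real_of_ereal (J x)"
      using lipschitz_on_continuous_on[OF L] af
      by (rule continuous_on_tendsto_compose) (use a R in auto)
    then have "(\<lambda>n. ereal (real_of_ereal (J (a (f n))))) \<longlonglongrightarrow> ereal (real_of_ereal (J x))"
      by simp
    then show "(\<lambda>n. J (a (f n))) \<longlonglongrightarrow> J x" using J a R by simp
    show "\<forall>n. - (g + e (f n) + \<zeta> (f n)) \<in> frechet_subdiff J (a (f n))" using sub by simp
    have "(\<lambda>n. - (g + e (f n) + \<zeta> (f n))) \<longlonglongrightarrow> - (g + 0 + l)"
      using f(2) by (intro tendsto_intros ef) (simp add: o_def)
    then show "(\<lambda>n. - (g + e (f n) + \<zeta> (f n))) \<longlonglongrightarrow> - (g + l)" by simp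
  qed
  ultimately show ?thesis by (intro bexI[of _ "- (g + l)"] bexI[of _ l]) auto
qed

text \<open>Up to a constant, \<open>- s\<close> is a global minorant of \<open>J\<close> touching
  at \<open>x\<close>, so the Frechet criterion applies directly.\<close>

lemma unconstrained_minimizer:
  fixes J :: "'a::euclidean_space \<Rightarrow> ereal"
  assumes fin: "\<bar>J x\<bar> \<noteq> \<infinity>"
    and s: "(s has_derivative (\<lambda>h. g \<bullet> h)) (at x)"
    and min: "\<And>y. J x + ereal (s x) \<le> J y + ereal (s y)"
  shows "- g \<in> limiting_subdiff J x"
proof -
  have "- g \<in> frechet_subdiff J x"
  proof (rule frechet_subdiffI[where f = J])
    show "\<bar>J x\<bar> \<noteq> \<infinity>" by fact
    show "((\<lambda>y. - s y) has_derivative (\<lambda>h. - g \<bullet> h)) (at x)"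
      using has_derivative_minus[OF s] by simp
    have "J x + ereal (- s y - - s x) \<le> J y" for y
      using min[of y] fin by (cases "J x"; cases "J y") auto
    then show "\<forall>\<^sub>F y in at x. J x + ereal (- s y - - s x) \<le> J y" by simp
  qed
  then show ?thesis using frechet_subdiff_subset_limiting by blast
qed

section \<open>Descent of the merit function\<close>

declare transpose_matrix_vector [simp del]

text \<open>Here \<open>r\<close> and \<open>r'\<close> are the old and new residuals,
  \<open>p + \<gamma> *\<^sub>R r'\<close> the updated multiplier and
  \<open>p + \<gamma> *\<^sub>R r\<close> the predictor \<open>q\<close>.\<close>

lemma multiplier_step_identity:
  fixes p r r' :: "'a::real_inner"
  shows "(p + \<gamma> *\<^sub>R r') \<bullet> r' - p \<bullet> r + \<gamma> / 2 * (norm r')\<^sup>2 - \<gamma> / 2 * (norm r)\<^sup>2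
           - (p + \<gamma> *\<^sub>R r) \<bullet> (r' - r)
         = \<gamma> * (norm r')\<^sup>2 + \<gamma> / 2 * (norm (r' - r))\<^sup>2"
  by (simp add: power2_norm_eq_inner inner_add_left inner_add_right inner_diff_left inner_diff_right
      inner_commute field_simps)

text \<open>For \<open>s\<close> the change of \<open>\<Theta>\<close> and \<open>b\<close> that of
  \<open>B v\<close>, the factor \<open>\<gamma> *\<^sub>R (s + b)\<close> on the right is a
  difference of consecutive multiplier steps.\<close>

lemma coupling_identity:
  fixes s b :: "'a::real_inner"
  shows "\<gamma> / 2 * (norm (s + b))\<^sup>2 - \<gamma> * (norm b)\<^sup>2
         = s \<bullet> (\<gamma> *\<^sub>R (s + b)) - \<gamma> / 2 * (norm s)\<^sup>2 - \<gamma> / 2 * (norm b)\<^sup>2"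
  by (simp add: power2_norm_eq_inner inner_add_left inner_add_right inner_commute field_simps)

lemma young_inner:
  fixes x y :: "'a::real_inner"
  assumes "0 < \<gamma>"
  shows "x \<bullet> y \<le> \<gamma> / 2 * (norm x)\<^sup>2 + 1 / (2 * \<gamma>) * (norm y)\<^sup>2"
proof -
  have "0 \<le> (norm (\<gamma> *\<^sub>R x - y))\<^sup>2" by simp
  also have "\<dots> = \<gamma>\<^sup>2 * (norm x)\<^sup>2 - 2 * \<gamma> * (x \<bullet> y) + (norm y)\<^sup>2"
    unfolding power2_norm_eq_inner
    by (simp add: inner_diff_left inner_diff_right inner_commute power2_eq_square algebra_simps)
  finally have "2 * \<gamma> * (x \<bullet> y) \<le> \<gamma>\<^sup>2 * (norm x)\<^sup>2 + (norm y)\<^sup>2" by simp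
  then show ?thesis using assms by (simp add: field_simps power2_eq_square)
qed

lemma sum3_squared_le: "(x + y + z)\<^sup>2 \<le> 3 * (x\<^sup>2 + y\<^sup>2 + z\<^sup>2)" for x y z :: real
proof -
  have "0 \<le> (x - y)\<^sup>2 + (y - z)\<^sup>2 + (x - z)\<^sup>2" by simp
  then show ?thesis by (simp add: power2_eq_square algebra_simps)
qed

lemma norm_triple_squared:
  "(norm (x, y, z))\<^sup>2 = (norm x)\<^sup>2 + (norm y)\<^sup>2 + (norm z)\<^sup>2"
  by (simp add: norm_Pair)

text \<open>The threshold is the positive root of \<open>z\<^sup>2 - a z - 14 a\<^sup>2\<close>.\<close>

lemma penalty_threshold:
  fixes z a :: real
  assumes "0 \<le> a" "0 < z" "(sqrt 57 + 1) / 2 * a < z"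
  shows "a / 2 + 7 * a\<^sup>2 / z < z / 2"
proof -
  have "1 < sqrt 57" by simp
  \<comment> \<open>The second factor comes from the negative root; the product is the quadratic
    because \<open>((sqrt 57)\<^sup>2 - 1) / 4 = 14\<close>.\<close>
  have "0 < (z - (sqrt 57 + 1) / 2 * a) * (z + (sqrt 57 - 1) / 2 * a)"
    using assms \<open>1 < sqrt 57\<close> by (intro mult_pos_pos add_pos_nonneg) auto
  also have "\<dots> = z\<^sup>2 - a * z - ((sqrt 57)\<^sup>2 - 1) / 4 * a\<^sup>2"
    by (simp add: power2_eq_square field_simps)
  also have "\<dots> = z\<^sup>2 - a * z - 14 * a\<^sup>2" by simp
  finally show ?thesis using assms by (simp add: field_simps power2_eq_square)
qed

text \<open>\<open>feasible\<close> gives the \<open>u\<close>-subproblems finite optimal values: if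
  \<open>J\<close> were infinite on all of \<open>U\<close>, every point of \<open>U\<close> would
  be a minimiser.\<close>

locale napp_run =
  fixes U :: "(real ^ 'n) set"
    and G :: "(real ^ 'n) \<times> (real ^ 'd) \<Rightarrow> real"
    and J :: "real ^ 'n \<Rightarrow> ereal"
    and H :: "real ^ 'd \<Rightarrow> real"
    and \<Omega> \<Phi> \<Theta> :: "real ^ 'n \<Rightarrow> real ^ 'm"
    and B :: "real ^ 'd ^ 'm"
    and K :: "real ^ 'n \<Rightarrow> real"
    and L\<^sub>G L\<^sub>H L\<^sub>\<Theta> L\<^sub>\<Omega> L\<^sub>K \<beta> \<gamma> \<sigma> lmin :: real
    and L\<^sub>\<Omega>\<^sub>j :: "'m \<Rightarrow> real"
    and \<delta> \<epsilon> :: "nat \<Rightarrow> real"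
    and u :: "nat \<Rightarrow> real ^ 'n"
    and v :: "nat \<Rightarrow> real ^ 'd"
    and p :: "nat \<Rightarrow> real ^ 'm"
  assumes U: "U \<noteq> {}" "closed U" "convex U"
    and Theta: "\<Theta> = (\<lambda>x. \<Omega> x + \<Phi> x)"
    and diff: "\<And>x. \<Omega> differentiable (at x)" "\<And>x. \<Phi> differentiable (at x)"
    and H1: "lipschitz_gradient L\<^sub>G G"
    and H2: "lipschitz_gradient L\<^sub>H H"
    and H3: "proper J" "lsc J"
            "U \<noteq> UNIV \<Longrightarrow> \<forall>x \<in> edom J \<inter> U. lipschitz_around J x"
    and H4: "L\<^sub>\<Theta>-lipschitz_on UNIV \<Theta>"
    and H5: "\<And>j. lipschitz_gradient (L\<^sub>\<Omega>\<^sub>j j) (\<lambda>x. \<Omega> x $ j)"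
            "L\<^sub>\<Omega> = (\<Sum>j\<in>UNIV. L\<^sub>\<Omega>\<^sub>j j)"
    and H6: "rank B = CARD('d)" "range \<Theta> \<subseteq> range ((*v) B)"
    and lmin: "lmin = lambda_min (transpose B ** B)"
    and K: "\<beta> > 0" "strongly_convex \<beta> K" "lipschitz_gradient L\<^sub>K K"
    and gamma: "\<gamma> > 0" "\<gamma> > (sqrt 57 + 1) / (2 * lmin) * (L\<^sub>G + L\<^sub>H)"
    and alg: "napp_al U G J H \<Omega> \<Phi> B K \<gamma> \<sigma> \<delta> \<epsilon> u v p"
    and delta: "\<And>k. \<delta> k = \<beta> * inverse
          (L\<^sub>G + norm (q_seq \<Theta> B \<gamma> u v p k) * L\<^sub>\<Omega> + \<gamma> * L\<^sub>\<Theta>\<^sup>2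
            + 14 * \<gamma> * (spectral_norm B)\<^sup>2 * L\<^sub>\<Theta>\<^sup>2 / lmin
            + 14 * (L\<^sub>G + \<gamma> * spectral_norm B * L\<^sub>\<Theta>)\<^sup>2 / (\<gamma> * lmin) + 1)"
    and feasible: "\<exists>x\<in>U. J x < \<infinity>"
begin

abbreviation "b \<equiv> spectral_norm B"

abbreviation "q \<equiv> q_seq \<Theta> B \<gamma> u v p"

abbreviation "w k \<equiv> (u k, v k, p k)"

definition residual where "residual k = \<Theta> (u k) + B *v v k"

text \<open>Partial gradients are components of the joint gradient, to which the Lipschitz constant
  \<open>L\<^sub>G\<close> refers.\<close>

definition grad_u where "grad_u k = fst (gradient G (u k, v k))"

definition grad_v where "grad_v k = snd (gradient G (u k, v k)) + gradient H (v k)"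

definition inv_step where "inv_step k = L\<^sub>G + norm (q k) * L\<^sub>\<Omega> + \<gamma> * L\<^sub>\<Theta>\<^sup>2
    + 14 * \<gamma> * b\<^sup>2 * L\<^sub>\<Theta>\<^sup>2 / lmin + 14 * (L\<^sub>G + \<gamma> * b * L\<^sub>\<Theta>)\<^sup>2 / (\<gamma> * lmin) + 1"

text \<open>Agrees with \<open>aug_lagrangian\<close> wherever \<open>J\<close> is finite. Where
  \<open>J\<close> is infinite its contribution is 0, which among the iterates can occur only at
  index 0.\<close>

definition lagr where "lagr = (\<lambda>(x, y, z). G (x, y) + real_of_ereal (J x) + H y
    + z \<bullet> (\<Theta> x + B *v y) + \<gamma> / 2 * (norm (\<Theta> x + B *v y))\<^sup>2)"

definition C1 where "C1 = 7 * (L\<^sub>G + \<gamma> * b * L\<^sub>\<Theta>)\<^sup>2 / (\<gamma> * lmin)"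

definition C2 where "C2 = 7 * (L\<^sub>G + L\<^sub>H)\<^sup>2 / (\<gamma> * lmin)"

definition merit where "merit k = lagr (w k) + (C1 * (norm (u (k - 1) - u k))\<^sup>2
    + C2 * (norm (v (k - 1) - v k))\<^sup>2 + 1 / (2 * \<gamma>) * (norm (p (k - 1) - p k))\<^sup>2)"

section \<open>Signs of the constants, step sizes and finiteness along the run\<close>

lemma nonneg: "0 \<le> L\<^sub>G" "0 \<le> L\<^sub>H" "0 \<le> L\<^sub>\<Theta>" "0 \<le> L\<^sub>\<Omega>" "0 \<le> b"
  using lipschitz_gradient_nonneg[OF H1] lipschitz_gradient_nonneg[OF H2] lipschitz_on_nonneg[OF H4]
    lipschitz_gradient_nonneg[OF H5(1)]
  by (auto simp: H5(2) sum_nonneg intro: onorm_pos_le matrix_vector_mul_bounded_linear)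

lemma lmin_pos: "0 < lmin"
  using lambda_min_gram(1)[OF H6(1)] by (simp add: lmin)

lemma Theta_lipschitz: "norm (\<Theta> x - \<Theta> y) \<le> L\<^sub>\<Theta> * norm (x - y)"
  using lipschitz_onD[OF H4, of x y] by (simp add: dist_norm)

lemma inv_step_ge_1: "1 \<le> inv_step k"
  using nonneg lmin_pos gamma(1) by (simp add: inv_step_def)

lemma algD:
  shows "0 < \<sigma>" "0 < \<delta> k" "\<sigma> * \<delta> k \<le> \<epsilon> k" "\<epsilon> k \<le> \<delta> k"
    and "is_arg_min (\<lambda>x. ereal (grad_u k \<bullet> x) + J x +
             ereal (q k \<bullet> (jacobian \<Omega> (at (u k)) *v x + \<Phi> x)) +
             ereal (1 / \<epsilon> k * bregman K x (u k))) (\<lambda>x. x \<in> U) (u (Suc k))"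
    and "is_arg_min (\<lambda>y. grad_v k \<bullet> y + q k \<bullet> (B *v y) + \<gamma> / 2 * (norm (B *v (y - v k)))\<^sup>2)
             (\<lambda>y. True) (v (Suc k))"
    and "p (Suc k) = p k + \<gamma> *\<^sub>R residual (Suc k)"
proof -
  have G: "G differentiable (at z)" for z using H1 unfolding lipschitz_gradient_def by blast
  show "0 < \<sigma>" "0 < \<delta> k" "\<sigma> * \<delta> k \<le> \<epsilon> k" "\<epsilon> k \<le> \<delta> k"
    "is_arg_min (\<lambda>x. ereal (grad_u k \<bullet> x) + J x +
             ereal (q k \<bullet> (jacobian \<Omega> (at (u k)) *v x + \<Phi> x)) +
             ereal (1 / \<epsilon> k * bregman K x (u k))) (\<lambda>x. x \<in> U) (u (Suc k))"
    "is_arg_min (\<lambda>y. grad_v k \<bullet> y + q k \<bullet> (B *v y) + \<gamma> / 2 * (norm (B *v (y - v k)))\<^sup>2)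
             (\<lambda>y. True) (v (Suc k))"
    "p (Suc k) = p k + \<gamma> *\<^sub>R residual (Suc k)"
    using alg unfolding napp_al_def Let_def Theta[symmetric] grad_u_def grad_v_def residual_def
      gradient_fst[OF G] gradient_snd[OF G] by auto
qed

lemma eps_pos: "0 < \<epsilon> k"
  using algD(1) algD(2,3)[of k] by (meson less_le_trans mult_pos_pos)

lemma delta_eq: "\<delta> k = \<beta> / inv_step k"
  by (simp add: delta inv_step_def divide_inverse)

text \<open>Serves the passage to the limit: \<open>1 / \<epsilon> k\<close> may fail to converge,
  whereas the bound converges with \<open>q\<close>.\<close>

lemma inverse_eps_le: "1 / \<epsilon> k \<le> inv_step k / (\<sigma> * \<beta>)"
proof -
  have "1 / \<epsilon> k \<le> 1 / (\<sigma> * \<delta> k)"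
    using algD(1) algD(2,3)[of k] by (intro divide_left_mono mult_pos_pos eps_pos) auto
  then show ?thesis using inv_step_ge_1[of k] K(1) by (simp add: delta_eq)
qed

lemma inv_step_le: "inv_step k \<le> \<beta> / \<epsilon> k"
proof -
  have "inv_step k * \<epsilon> k \<le> inv_step k * \<delta> k"
    using algD(4) inv_step_ge_1[of k] by (intro mult_left_mono) auto
  also have "\<dots> = \<beta>" using inv_step_ge_1[of k] by (simp add: delta_eq)
  finally show ?thesis using eps_pos[of k] by (simp add: pos_le_divide_eq)
qed

lemma J_not_minf: "J x \<noteq> -\<infinity>"
  using H3(1) by (simp add: proper_def)

lemma u_in_U: "u (Suc k) \<in> U"
  using algD(5) by (auto simp: is_arg_min_def)

text \<open>The minimiser does no worse than a feasible point, whose objective value is finite.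
  Index 0 is excluded since the start is arbitrary.\<close>

lemma J_u_finite: "\<bar>J (u (Suc k))\<bar> \<noteq> \<infinity>"
proof -
  obtain x where x: "x \<in> U" "J x < \<infinity>" using feasible by auto
  then have "\<not> ereal (grad_u k \<bullet> x) + J x +
             ereal (q k \<bullet> (jacobian \<Omega> (at (u k)) *v x + \<Phi> x)) +
             ereal (1 / \<epsilon> k * bregman K x (u k)) < \<infinity> \<or> J (u (Suc k)) \<noteq> \<infinity>"
    using algD(5)[of k] unfolding is_arg_min_def by force
  with x J_not_minf[of x] J_not_minf[of "u (Suc k)"] show ?thesis by (cases "J x") auto
qed

lemma u_step:
  assumes x: "x \<in> U" "J x = ereal c"
  shows "grad_u k \<bullet> u (Suc k) + real_of_ereal (J (u (Suc k)))
       + q k \<bullet> (jacobian \<Omega> (at (u k)) *v u (Suc k) + \<Phi> (u (Suc k)))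
       + 1 / \<epsilon> k * bregman K (u (Suc k)) (u k)
     \<le> grad_u k \<bullet> x + c + q k \<bullet> (jacobian \<Omega> (at (u k)) *v x + \<Phi> x) + 1 / \<epsilon> k * bregman K x (u k)"
proof -
  obtain d where "J (u (Suc k)) = ereal d" using J_u_finite[of k] by auto
  with algD(5)[of k] x show ?thesis unfolding is_arg_min_def by (auto simp: not_less dest!: spec[of _ x])
qed

text \<open>Perturbing the minimiser by \<open>t *\<^sub>R h\<close> changes the objective by a
  quadratic polynomial in \<open>t\<close> without constant term, so its linear coefficient
  vanishes.\<close>

lemma v_optimality: "grad_v k + transpose B *v (q k + \<gamma> *\<^sub>R (B *v (v (Suc k) - v k))) = 0"
proof -
  define D where "D = grad_v k + transpose B *v (q k + \<gamma> *\<^sub>R (B *v (v (Suc k) - v k)))"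
  have "D \<bullet> h = 0" for h
  proof (rule quadratic_nonneg_imp_linear_zero)
    fix t :: real
    define y where "y = v (Suc k) + t *\<^sub>R h"
    define z where "z = B *v (v (Suc k) - v k)"
    have Bz: "B *v (y - v k) = z + t *\<^sub>R (B *v h)"
      by (simp add: y_def z_def matrix_vector_right_distrib matrix_vector_mult_diff_distrib
          matrix_vector_mult_scaleR)
    have "grad_v k \<bullet> v (Suc k) + q k \<bullet> (B *v v (Suc k)) + \<gamma> / 2 * (norm z)\<^sup>2
        \<le> grad_v k \<bullet> y + q k \<bullet> (B *v y) + \<gamma> / 2 * (norm (B *v (y - v k)))\<^sup>2"
      using algD(6)[of k] unfolding is_arg_min_def z_def not_less[symmetric] by blast
    also note Bz
    also have "(norm (z + t *\<^sub>R (B *v h)))\<^sup>2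
        = (norm z)\<^sup>2 + 2 * t * (z \<bullet> (B *v h)) + t\<^sup>2 * (norm (B *v h))\<^sup>2"
      unfolding power2_norm_eq_inner
      by (simp add: inner_add_left inner_add_right inner_commute power2_eq_square algebra_simps)
    finally have "0 \<le> t * (grad_v k \<bullet> h + q k \<bullet> (B *v h) + \<gamma> * (z \<bullet> (B *v h)))
        + \<gamma> / 2 * (norm (B *v h))\<^sup>2 * t\<^sup>2"
      by (simp add: y_def inner_add_right matrix_vector_right_distrib matrix_vector_mult_scaleR
          algebra_simps)
    also have "grad_v k \<bullet> h + q k \<bullet> (B *v h) + \<gamma> * (z \<bullet> (B *v h)) = D \<bullet> h"
      by (simp add: D_def z_def inner_add_left inner_matrix_mult[symmetric])
    finally show "0 \<le> D \<bullet> h * t + \<gamma> / 2 * (norm (B *v h))\<^sup>2 * t\<^sup>2" by (simp add: mult.commute)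
  qed
  then have "D = 0" by (metis inner_eq_zero_iff)
  then show ?thesis by (simp add: D_def)
qed

text \<open>In the \<open>v\<close>-optimality condition, \<open>q k\<close> and the proximal term
  combine to the new multiplier minus \<open>\<gamma>\<close> times the change of
  \<open>\<Theta>\<close>.\<close>

lemma multiplier_eq:
  "transpose B *v p (Suc k) = \<gamma> *\<^sub>R (transpose B *v (\<Theta> (u (Suc k)) - \<Theta> (u k))) - grad_v k"
proof -
  have "q k + \<gamma> *\<^sub>R (B *v (v (Suc k) - v k))
      = p (Suc k) - \<gamma> *\<^sub>R (\<Theta> (u (Suc k)) - \<Theta> (u k))"
    by (simp add: algD(7) q_seq_def residual_def matrix_vector_mult_diff_distrib algebra_simps)
  with v_optimality[of k] have "grad_v k + (transpose B *v p (Suc k)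
      - \<gamma> *\<^sub>R (transpose B *v (\<Theta> (u (Suc k)) - \<Theta> (u k)))) = 0"
    by (simp add: matrix_vector_mult_diff_distrib matrix_vector_mult_scaleR)
  then show ?thesis by (simp add: algebra_simps eq_neg_iff_add_eq_0)
qed

section \<open>Control of the multiplier steps by the primal steps\<close>

lemma grad_v_bound:
  "norm (grad_v (Suc k) - grad_v k)
     \<le> L\<^sub>G * norm (u (Suc k) - u k) + (L\<^sub>G + L\<^sub>H) * norm (v (Suc k) - v k)"
proof -
  have "norm (snd z) \<le> norm z" for z :: "(real^'n) \<times> (real^'d)"
    by (cases z) (simp add: norm_snd_le)
  from this[of "gradient G (u (Suc k), v (Suc k)) - gradient G (u k, v k)"]
  have "norm (snd (gradient G (u (Suc k), v (Suc k))) - snd (gradient G (u k, v k)))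
      \<le> norm (gradient G (u (Suc k), v (Suc k)) - gradient G (u k, v k))"
    by simp
  also have "\<dots> \<le> L\<^sub>G * norm ((u (Suc k), v (Suc k)) - (u k, v k))"
    by (rule lipschitz_gradient_bound[OF H1])
  also have "\<dots> \<le> L\<^sub>G * (norm (u (Suc k) - u k) + norm (v (Suc k) - v k))"
    using nonneg norm_Pair_le by (intro mult_left_mono) auto
  finally have 1: "norm (snd (gradient G (u (Suc k), v (Suc k))) - snd (gradient G (u k, v k)))
      \<le> L\<^sub>G * (norm (u (Suc k) - u k) + norm (v (Suc k) - v k))" .
  have 2: "norm (gradient H (v (Suc k)) - gradient H (v k)) \<le> L\<^sub>H * norm (v (Suc k) - v k)"
    by (rule lipschitz_gradient_bound[OF H2])
  have "norm (grad_v (Suc k) - grad_v k)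
      \<le> norm (snd (gradient G (u (Suc k), v (Suc k))) - snd (gradient G (u k, v k)))
        + norm (gradient H (v (Suc k)) - gradient H (v k))"
    unfolding grad_v_def add_diff_add by (rule norm_triangle_ineq)
  with 1 2 show ?thesis by (simp add: algebra_simps)
qed

lemma residual_range: "residual k \<in> range ((*v) B)"
proof -
  obtain y where "\<Theta> (u k) = B *v y" using H6(2) by auto
  then have "residual k = B *v (y + v k)" by (simp add: residual_def matrix_vector_right_distrib)
  then show ?thesis by blast
qed

text \<open>Two consecutive instances of \<open>multiplier_eq\<close> are subtracted. The older
  \<open>u\<close>-step enters through both \<open>grad_v\<close> and \<open>\<Theta>\<close>, the
  newer one through \<open>\<Theta>\<close> only; the factor 3 comes from squaring three
  terms.\<close>

lemma multiplier_bound: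
  "lmin * (norm (p (Suc (Suc k)) - p (Suc k)))\<^sup>2
     \<le> 3 * ((L\<^sub>G + \<gamma> * b * L\<^sub>\<Theta>)\<^sup>2 * (norm (u (Suc k) - u k))\<^sup>2
          + (L\<^sub>G + L\<^sub>H)\<^sup>2 * (norm (v (Suc k) - v k))\<^sup>2
          + (\<gamma> * b * L\<^sub>\<Theta>)\<^sup>2 * (norm (u (Suc (Suc k)) - u (Suc k)))\<^sup>2)"
proof -
  define P where "P = p (Suc (Suc k)) - p (Suc k)"
  define T where "T k = \<Theta> (u (Suc k)) - \<Theta> (u k)" for k
  have BT: "norm (\<gamma> *\<^sub>R (transpose B *v T k)) \<le> \<gamma> * b * L\<^sub>\<Theta> * norm (u (Suc k) - u k)" for k
  proof -
    have "norm (transpose B *v T k) \<le> b * (L\<^sub>\<Theta> * norm (u (Suc k) - u k))"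
      by (rule order_trans[OF norm_transpose_le_spectral_norm])
         (use nonneg Theta_lipschitz in \<open>auto simp: T_def intro!: mult_left_mono\<close>)
    from mult_left_mono[OF this, of \<gamma>] show ?thesis using gamma(1) by (simp add: mult_ac)
  qed
  have "transpose B *v P = \<gamma> *\<^sub>R (transpose B *v T (Suc k)) - \<gamma> *\<^sub>R (transpose B *v T k)
      - (grad_v (Suc k) - grad_v k)"
    by (simp add: P_def T_def matrix_vector_mult_diff_distrib[of "transpose B" "p _"] multiplier_eq)
  also have "norm \<dots> \<le> norm (\<gamma> *\<^sub>R (transpose B *v T (Suc k))) + norm (\<gamma> *\<^sub>R (transpose B *v T k))
      + norm (grad_v (Suc k) - grad_v k)"
    by (intro order_trans[OF norm_triangle_ineq4] add_mono norm_triangle_ineq4 order_refl)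
  also have "\<dots> \<le> (L\<^sub>G + \<gamma> * b * L\<^sub>\<Theta>) * norm (u (Suc k) - u k)
      + (L\<^sub>G + L\<^sub>H) * norm (v (Suc k) - v k) + \<gamma> * b * L\<^sub>\<Theta> * norm (u (Suc (Suc k)) - u (Suc k))"
    using BT[of k] BT[of "Suc k"] grad_v_bound[of k] by (simp add: algebra_simps)
  finally have "(norm (transpose B *v P))\<^sup>2 \<le> ((L\<^sub>G + \<gamma> * b * L\<^sub>\<Theta>) * norm (u (Suc k) - u k)
      + (L\<^sub>G + L\<^sub>H) * norm (v (Suc k) - v k) + \<gamma> * b * L\<^sub>\<Theta> * norm (u (Suc (Suc k)) - u (Suc k)))\<^sup>2"
    by (rule power_mono) simp
  also note sum3_squared_le
  finally have "(norm (transpose B *v P))\<^sup>2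
      \<le> 3 * ((L\<^sub>G + \<gamma> * b * L\<^sub>\<Theta>)\<^sup>2 * (norm (u (Suc k) - u k))\<^sup>2
          + (L\<^sub>G + L\<^sub>H)\<^sup>2 * (norm (v (Suc k) - v k))\<^sup>2
          + (\<gamma> * b * L\<^sub>\<Theta>)\<^sup>2 * (norm (u (Suc (Suc k)) - u (Suc k)))\<^sup>2)"
    by (simp add: power_mult_distrib)
  moreover have "P \<in> range ((*v) B)"
  proof -
    obtain y where "residual (Suc (Suc k)) = B *v y" using residual_range by blast
    then have "P = B *v (\<gamma> *\<^sub>R y)"
      by (simp add: P_def algD(7)[of "Suc k"] matrix_vector_mult_scaleR)
    then show ?thesis by blast
  qed
  note lambda_min_gram_range[OF H6(1) this]
  ultimately show ?thesis by (simp add: P_def lmin)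
qed

text \<open>The smallest of the coefficients left over for the squared \<open>u\<close>-,
  \<open>v\<close>- and \<open>p\<close>-steps.\<close>

definition slack where "slack = Min {1 / 2, \<gamma> * lmin / 2 - (L\<^sub>G + L\<^sub>H) / 2 - C2, 1 / (3 * \<gamma>)}"

lemma slack_pos: "0 < slack"
proof -
  have "(sqrt 57 + 1) / 2 * (L\<^sub>G + L\<^sub>H) < \<gamma> * lmin"
    using gamma(2) lmin_pos by (simp add: field_simps)
  \<comment> \<open>The threshold lemma with \<open>z = \<gamma> * lmin\<close> and
    \<open>a = L\<^sub>G + L\<^sub>H\<close>: the bound on \<open>\<gamma>\<close> is what makes the
    \<open>v\<close>-coefficient positive.\<close>
  then have "(L\<^sub>G + L\<^sub>H) / 2 + C2 < \<gamma> * lmin / 2"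
    unfolding C2_def using nonneg gamma(1) lmin_pos by (intro penalty_threshold) auto
  then have "0 < \<gamma> * lmin / 2 - (L\<^sub>G + L\<^sub>H) / 2 - C2" by linarith
  then show ?thesis using gamma(1) by (simp only: slack_def) simp
qed

text \<open>Starts at index 1, because it compares with \<open>J (u n)\<close> and uses the
  multiplier equation for \<open>p n\<close>, neither of which is available at the arbitrary
  start.\<close>

lemma merit_descent:
  "merit (Suc (Suc k)) + slack * (norm (w (Suc k) - w (Suc (Suc k))))\<^sup>2 \<le> merit (Suc k)"
proof -
  define n where "n = Suc k"
  define du where "du = u (Suc n) - u n"
  define dv where "dv = v (Suc n) - v n"
  define T where "T = \<Theta> (u (Suc n)) - \<Theta> (u n)"
  define P where "P = p (Suc n) - p n"
  define P0 where "P0 = p n - p k"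
  define r where "r = residual n"
  define r' where "r' = residual (Suc n)"
  define x where "x = norm du"
  define y where "y = norm dv"
  define x0 where "x0 = norm (u n - u k)"
  define y0 where "y0 = norm (v n - v k)"
  define Ln where "Ln = L\<^sub>G + norm (q n) * L\<^sub>\<Omega>"

  \<comment> \<open>One-step estimates of the single terms\<close>
  have P: "P = \<gamma> *\<^sub>R r'" and P0: "P0 = \<gamma> *\<^sub>R r"
    by (simp_all add: P_def P0_def r_def r'_def n_def algD(7))
  have q: "q n = p n + \<gamma> *\<^sub>R r" by (simp add: q_seq_def r_def residual_def)
  have dr: "r' - r = T + B *v dv"
    by (simp add: r_def r'_def residual_def T_def dv_def matrix_vector_mult_diff_distrib)
  have step_u: "grad_u n \<bullet> du + (real_of_ereal (J (u (Suc n))) - real_of_ereal (J (u n)))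
      + q n \<bullet> (jacobian \<Omega> (at (u n)) *v du + \<Phi> (u (Suc n)) - \<Phi> (u n)) + \<beta> / (2 * \<epsilon> n) * x\<^sup>2 \<le> 0"
  proof -
    have "J (u n) = ereal (real_of_ereal (J (u n)))"
      using J_u_finite[of k] by (simp add: n_def ereal_real)
    note u_step[OF _ this, of n]
    moreover have "u n \<in> U" using u_in_U by (simp add: n_def)
    moreover have "bregman K (u n) (u n) = 0" by (simp add: bregman_def)
    moreover have "\<beta> / (2 * \<epsilon> n) * x\<^sup>2 \<le> 1 / \<epsilon> n * bregman K (u (Suc n)) (u n)"
    proof -
      have "\<beta> / 2 * x\<^sup>2 \<le> bregman K (u (Suc n)) (u n)"
        unfolding x_def du_def using K by (intro bregman_ge) (auto simp: lipschitz_gradient_def)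
      from mult_left_mono[OF this, of "1 / \<epsilon> n"] eps_pos[of n] show ?thesis by simp
    qed
    ultimately show ?thesis
      by (simp add: du_def inner_diff_right inner_add_right matrix_vector_mult_diff_distrib)
  qed
  have step_G: "G (u (Suc n), v (Suc n)) - G (u n, v n)
      \<le> grad_u n \<bullet> du + snd (gradient G (u n, v n)) \<bullet> dv + L\<^sub>G / 2 * (x\<^sup>2 + y\<^sup>2)"
    using descent_upper[OF H1, of "(u (Suc n), v (Suc n))" "(u n, v n)"]
    by (simp add: grad_u_def du_def dv_def x_def y_def inner_prod_def norm_Pair)
  have step_H: "H (v (Suc n)) - H (v n) \<le> gradient H (v n) \<bullet> dv + L\<^sub>H / 2 * y\<^sup>2"
    using descent_upper[OF H2, of "v (Suc n)" "v n"] by (simp add: dv_def y_def)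
  \<comment> \<open>\<open>\<Phi>\<close> enters the subproblem unlinearised and cancels; only
    \<open>\<Omega>\<close> leaves an error.\<close>
  have step_\<Omega>: "q n \<bullet> T - q n \<bullet> (jacobian \<Omega> (at (u n)) *v du + \<Phi> (u (Suc n)) - \<Phi> (u n))
      \<le> norm (q n) * L\<^sub>\<Omega> / 2 * x\<^sup>2"
    using jacobian_linearization_error[OF diff(1) H5(1), of "q n" "u (Suc n)" "u n"]
    by (simp add: T_def Theta H5(2) du_def x_def inner_diff_right inner_add_right)
  have step_v: "snd (gradient G (u n, v n)) \<bullet> dv + gradient H (v n) \<bullet> dv
      = - (q n \<bullet> (B *v dv)) - \<gamma> * (norm (B *v dv))\<^sup>2"
  proof -
    have "(grad_v n + transpose B *v (q n + \<gamma> *\<^sub>R (B *v dv))) \<bullet> dv = 0"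
      using v_optimality[of n] by (simp add: dv_def)
    then show ?thesis
      by (simp add: grad_v_def inner_add_left inner_matrix_mult[symmetric] power2_norm_eq_inner)
  qed

  \<comment> \<open>Change of the augmented Lagrangian\<close>
  have lagr_eq: "lagr (w i) = G (u i, v i) + real_of_ereal (J (u i)) + H (v i) + p i \<bullet> residual i
      + \<gamma> / 2 * (norm (residual i))\<^sup>2" for i
    by (simp add: lagr_def residual_def)
  have mult: "p (Suc n) \<bullet> r' - p n \<bullet> r + \<gamma> / 2 * (norm r')\<^sup>2 - \<gamma> / 2 * (norm r)\<^sup>2
      - q n \<bullet> (T + B *v dv) = \<gamma> * (norm r')\<^sup>2 + \<gamma> / 2 * (norm (T + B *v dv))\<^sup>2"
    using multiplier_step_identity[of "p n" \<gamma> r' r] unfolding dr q[symmetric]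
    by (simp only: r'_def algD(7)[of n])
  have P_norm: "\<gamma> * (norm r')\<^sup>2 = 1 / \<gamma> * (norm P)\<^sup>2"
    using gamma(1) by (simp add: P power_mult_distrib power2_eq_square)
  have "lagr (w (Suc n)) - lagr (w n) \<le> (Ln - \<beta> / \<epsilon> n) / 2 * x\<^sup>2 + (L\<^sub>G + L\<^sub>H) / 2 * y\<^sup>2
      + 1 / \<gamma> * (norm P)\<^sup>2 + (\<gamma> / 2 * (norm (T + B *v dv))\<^sup>2 - \<gamma> * (norm (B *v dv))\<^sup>2)"
  proof -
    have "(Ln - \<beta> / \<epsilon> n) / 2 * x\<^sup>2 = L\<^sub>G / 2 * x\<^sup>2 + norm (q n) * L\<^sub>\<Omega> / 2 * x\<^sup>2 - \<beta> / (2 * \<epsilon> n) * x\<^sup>2"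
      using eps_pos[of n] by (simp add: Ln_def field_simps)
    moreover have "(L\<^sub>G + L\<^sub>H) / 2 * y\<^sup>2 = L\<^sub>G / 2 * y\<^sup>2 + L\<^sub>H / 2 * y\<^sup>2"
      by (simp add: field_simps)
    moreover have "L\<^sub>G / 2 * (x\<^sup>2 + y\<^sup>2) = L\<^sub>G / 2 * x\<^sup>2 + L\<^sub>G / 2 * y\<^sup>2" by (rule distrib_left)
    moreover have "q n \<bullet> (T + B *v dv) = q n \<bullet> T + q n \<bullet> (B *v dv)" by (rule inner_add_right)
    ultimately show ?thesis
      using step_u step_G step_H step_\<Omega> step_v mult P_norm
      unfolding lagr_eq r_def[symmetric] r'_def[symmetric] by linarith
  qed
  \<comment> \<open>The two Young inequalities together cost
    \<open>\<gamma> * (norm T)\<^sup>2\<close>, half of which the coupling identity returns.\<close>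
  also have "\<gamma> / 2 * (norm (T + B *v dv))\<^sup>2 - \<gamma> * (norm (B *v dv))\<^sup>2
      \<le> \<gamma> / 2 * (norm T)\<^sup>2 + 1 / (2 * \<gamma>) * (norm P)\<^sup>2 + 1 / (2 * \<gamma>) * (norm P0)\<^sup>2
        - \<gamma> / 2 * (norm (B *v dv))\<^sup>2"
  proof -
    have "\<gamma> *\<^sub>R (T + B *v dv) = P - P0" by (simp add: P P0 dr[symmetric] scaleR_diff_right)
    then have "\<gamma> / 2 * (norm (T + B *v dv))\<^sup>2 - \<gamma> * (norm (B *v dv))\<^sup>2
        = T \<bullet> P + T \<bullet> (- P0) - \<gamma> / 2 * (norm T)\<^sup>2 - \<gamma> / 2 * (norm (B *v dv))\<^sup>2"
      unfolding coupling_identity by (simp add: inner_diff_right)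
    then show ?thesis using young_inner[OF gamma(1), of T P] young_inner[OF gamma(1), of T "- P0"]
      by (simp add: algebra_simps)
  qed
  moreover have "1 / \<gamma> * (norm P)\<^sup>2 + 1 / (2 * \<gamma>) * (norm P)\<^sup>2 = 3 / (2 * \<gamma>) * (norm P)\<^sup>2"
    using gamma(1) by (simp add: field_simps)
  ultimately have 1: "lagr (w (Suc n)) - lagr (w n) \<le> (Ln - \<beta> / \<epsilon> n) / 2 * x\<^sup>2 + (L\<^sub>G + L\<^sub>H) / 2 * y\<^sup>2
      + 3 / (2 * \<gamma>) * (norm P)\<^sup>2 + \<gamma> / 2 * (norm T)\<^sup>2 + 1 / (2 * \<gamma>) * (norm P0)\<^sup>2
      - \<gamma> / 2 * (norm (B *v dv))\<^sup>2"
    by linarith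

  \<comment> \<open>Absorption into the merit terms\<close>
  have T: "\<gamma> / 2 * (norm T)\<^sup>2 \<le> \<gamma> / 2 * L\<^sub>\<Theta>\<^sup>2 * x\<^sup>2"
  proof -
    have "(norm T)\<^sup>2 \<le> (L\<^sub>\<Theta> * x)\<^sup>2"
      using Theta_lipschitz by (intro power_mono) (auto simp: T_def x_def du_def)
    from mult_left_mono[OF this, of "\<gamma> / 2"] gamma(1) show ?thesis
      by (simp add: power_mult_distrib)
  qed
  have BV: "\<gamma> / 2 * (lmin * y\<^sup>2) \<le> \<gamma> / 2 * (norm (B *v dv))\<^sup>2"
    using lambda_min_gram(2)[OF H6(1), of dv] gamma(1) by (intro mult_left_mono) (auto simp: lmin y_def)
  \<comment> \<open>Scaling by \<open>7 / (3 * \<gamma> * lmin)\<close> turns the factor 3 of the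
    multiplier bound into the 7 of \<open>C1\<close> and \<open>C2\<close>. The older steps cost
    what \<open>merit n\<close> holds for them; the newer \<open>u\<close>-step is left to the step
    size.\<close>
  have PP: "7 / (3 * \<gamma>) * (norm P)\<^sup>2 \<le> C1 * x0\<^sup>2 + C2 * y0\<^sup>2 + 7 * \<gamma> * b\<^sup>2 * L\<^sub>\<Theta>\<^sup>2 / lmin * x\<^sup>2"
  proof -
    have "7 / (3 * \<gamma> * lmin) * (lmin * (norm P)\<^sup>2)
        \<le> 7 / (3 * \<gamma> * lmin) * (3 * ((L\<^sub>G + \<gamma> * b * L\<^sub>\<Theta>)\<^sup>2 * x0\<^sup>2 + (L\<^sub>G + L\<^sub>H)\<^sup>2 * y0\<^sup>2
          + (\<gamma> * b * L\<^sub>\<Theta>)\<^sup>2 * x\<^sup>2))"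
      using multiplier_bound[of k] gamma(1) lmin_pos
      by (intro mult_left_mono) (simp_all add: P_def n_def x0_def y0_def x_def du_def)
    also have "\<dots> = C1 * x0\<^sup>2 + C2 * y0\<^sup>2 + 7 * \<gamma> * b\<^sup>2 * L\<^sub>\<Theta>\<^sup>2 / lmin * x\<^sup>2"
      using gamma(1) lmin_pos unfolding C1_def C2_def
      by (simp add: power_mult_distrib field_simps power2_eq_square[of \<gamma>])
    finally show ?thesis using lmin_pos by simp
  qed
  \<comment> \<open>\<open>inv_step\<close> contains twice the remaining
    \<open>u\<close>-coefficients, hence the two factors 14; its last summand 1 leaves
    \<open>- (1 / 2)\<close>.\<close>
  have X: "(Ln - \<beta> / \<epsilon> n) / 2 * x\<^sup>2 + \<gamma> / 2 * L\<^sub>\<Theta>\<^sup>2 * x\<^sup>2 + 7 * \<gamma> * b\<^sup>2 * L\<^sub>\<Theta>\<^sup>2 / lmin * x\<^sup>2 + C1 * x\<^sup>2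
      \<le> - (1 / 2) * x\<^sup>2"
  proof -
    have aux: "(l - e) / 2 + t / 2 + s + c \<le> - (1 / 2)"
      if "i = l + t + 2 * s + 2 * c + 1" "i \<le> e" for i l t s c e :: real
      using that by (simp add: field_simps)
    have "inv_step n = Ln + \<gamma> * L\<^sub>\<Theta>\<^sup>2 + 2 * (7 * \<gamma> * b\<^sup>2 * L\<^sub>\<Theta>\<^sup>2 / lmin) + 2 * C1 + 1"
      by (simp add: inv_step_def Ln_def C1_def)
    then have "(Ln - \<beta> / \<epsilon> n) / 2 + \<gamma> / 2 * L\<^sub>\<Theta>\<^sup>2 + 7 * \<gamma> * b\<^sup>2 * L\<^sub>\<Theta>\<^sup>2 / lmin + C1 \<le> - (1 / 2)"
      using aux[OF _ inv_step_le, of n Ln "\<gamma> * L\<^sub>\<Theta>\<^sup>2"] by simp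
    from mult_right_mono[OF this, of "x\<^sup>2"] show ?thesis by (simp only: distrib_right) simp
  qed

  \<comment> \<open>Collected decrease\<close>
  have "merit (Suc n) - merit n \<le> - (1 / 2) * x\<^sup>2
      - (\<gamma> * lmin / 2 - (L\<^sub>G + L\<^sub>H) / 2 - C2) * y\<^sup>2 - 1 / (3 * \<gamma>) * (norm P)\<^sup>2"
  proof -
    have m1: "merit (Suc n) = lagr (w (Suc n)) + (C1 * x\<^sup>2 + C2 * y\<^sup>2 + 1 / (2 * \<gamma>) * (norm P)\<^sup>2)"
      by (simp add: merit_def x_def y_def P_def du_def dv_def norm_minus_commute)
    have m0: "merit n = lagr (w n) + (C1 * x0\<^sup>2 + C2 * y0\<^sup>2 + 1 / (2 * \<gamma>) * (norm P0)\<^sup>2)"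
      by (simp add: merit_def x0_def y0_def P0_def n_def norm_minus_commute)
    \<comment> \<open>The total \<open>2 / \<gamma>\<close> is enlarged to
      \<open>7 / (3 * \<gamma>)\<close>, which \<open>PP\<close> pays for; the surplus
      \<open>1 / (3 * \<gamma>)\<close> becomes decrease in the multiplier step.\<close>
    have pp: "3 / (2 * \<gamma>) * (norm P)\<^sup>2 + 1 / (2 * \<gamma>) * (norm P)\<^sup>2
        = 7 / (3 * \<gamma>) * (norm P)\<^sup>2 - 1 / (3 * \<gamma>) * (norm P)\<^sup>2"
      using gamma(1) by (simp add: field_simps)
    have yy: "(\<gamma> * lmin / 2 - (L\<^sub>G + L\<^sub>H) / 2 - C2) * y\<^sup>2
        = \<gamma> / 2 * (lmin * y\<^sup>2) - (L\<^sub>G + L\<^sub>H) / 2 * y\<^sup>2 - C2 * y\<^sup>2"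
      by (simp add: algebra_simps)
    show ?thesis using 1 T BV PP X pp unfolding m1 m0 yy by linarith
  qed
  moreover have "slack * (norm (w n - w (Suc n)))\<^sup>2
      \<le> (1 / 2) * x\<^sup>2 + (\<gamma> * lmin / 2 - (L\<^sub>G + L\<^sub>H) / 2 - C2) * y\<^sup>2 + 1 / (3 * \<gamma>) * (norm P)\<^sup>2"
  proof -
    have "(norm (w n - w (Suc n)))\<^sup>2 = x\<^sup>2 + y\<^sup>2 + (norm P)\<^sup>2"
      by (simp add: norm_triple_squared x_def y_def P_def du_def dv_def norm_minus_commute)
    moreover have "slack \<le> 1 / 2" "slack \<le> \<gamma> * lmin / 2 - (L\<^sub>G + L\<^sub>H) / 2 - C2" "slack \<le> 1 / (3 * \<gamma>)"
      unfolding slack_def by (rule Min_le; simp)+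
    then have "slack * x\<^sup>2 \<le> (1 / 2) * x\<^sup>2"
      "slack * y\<^sup>2 \<le> (\<gamma> * lmin / 2 - (L\<^sub>G + L\<^sub>H) / 2 - C2) * y\<^sup>2"
      "slack * (norm P)\<^sup>2 \<le> 1 / (3 * \<gamma>) * (norm P)\<^sup>2"
      by - (rule mult_right_mono, assumption, simp)+
    ultimately show ?thesis by (simp add: distrib_left)
  qed
  ultimately show ?thesis by (simp add: n_def)
qed

end

section \<open>Stationarity and convergence\<close>

text \<open>\<open>lsc\<close> speaks of punctured neighbourhoods only, yet the sequence may hit
  \<open>a\<close>; since \<open>ereal d < f a\<close> also holds, the lower bound extends to full
  neighbourhoods.\<close>

lemma lsc_le_of_tendsto:
  fixes f :: "'a::metric_space \<Rightarrow> ereal"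
  assumes f: "lsc f" and x: "x \<longlonglongrightarrow> a" and le: "\<And>n. f (x n) \<le> ereal (\<rho> n)" and \<rho>: "\<rho> \<longlonglongrightarrow> c"
  shows "f a \<le> ereal c"
proof (rule ccontr)
  assume "\<not> f a \<le> ereal c"
  then have "ereal c < f a" by simp
  then obtain d where d: "c < d" "ereal d < f a"
    using ereal_dense2[of "ereal c" "f a"] by auto
  then have "ereal d < Liminf (at a) f" using f by (auto simp: lsc_def intro: less_le_trans)
  then have "\<forall>\<^sub>F y in at a. ereal d < f y" by (rule less_LiminfD)
  then have "\<forall>\<^sub>F y in nhds a. ereal d < f y"
    using d(2) by (auto simp: eventually_at_filter elim!: eventually_mono)
  then have "\<forall>\<^sub>F n in sequentially. ereal d < f (x n)" using x by (rule eventually_compose_filterlim)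
  moreover have "\<forall>\<^sub>F n in sequentially. \<rho> n < d" using \<rho> d(1) by (rule order_tendstoD)
  ultimately have "\<forall>\<^sub>F n in sequentially. False"
  proof eventually_elim
    case (elim n)
    from less_le_trans[OF elim(1) le[of n]] elim(2) show ?case by simp
  qed
  then show False by simp
qed

context napp_run
begin

text \<open>Consecutive iterates share one limit, so the multiplier update forces feasibility, and
  \<open>q\<close> tends to \<open>pb\<close>.\<close>

lemma stationary_limit:
  assumes ub: "u \<longlonglongrightarrow> ub" and vb: "v \<longlonglongrightarrow> vb" and pb: "p \<longlonglongrightarrow> pb"
    and J_ub: "\<bar>J ub\<bar> \<noteq> \<infinity>"
  shows "stationary_point U G J H \<Theta> B (ub, vb, pb)"
proof -
  have u': "(\<lambda>k. u (Suc k)) \<longlonglongrightarrow> ub" and v': "(\<lambda>k. v (Suc k)) \<longlonglongrightarrow> vb"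
    and p': "(\<lambda>k. p (Suc k)) \<longlonglongrightarrow> pb"
    using ub vb pb by (auto intro: LIMSEQ_Suc)
  have ubU: "ub \<in> U" by (rule closed_sequentially[OF U(2) _ u']) (use u_in_U in auto)
  have G: "G differentiable (at z)" for z using H1 unfolding lipschitz_gradient_def by blast
  have Theta_lim: "(\<lambda>k. \<Theta> (x k)) \<longlonglongrightarrow> \<Theta> a" if "x \<longlonglongrightarrow> a" for x a
    using continuous_on_tendsto_compose[OF lipschitz_on_continuous_on[OF H4] that] by simp
  have B_lim: "(\<lambda>k. A *v x k) \<longlonglongrightarrow> A *v a" if "x \<longlonglongrightarrow> a" for A :: "real^'i^'j" and x a
    by (rule bounded_linear.tendsto[OF matrix_vector_mul_bounded_linear that])
  have grad_lim: "(\<lambda>k. gradient G (u k, v k)) \<longlonglongrightarrow> gradient G (ub, vb)"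
    by (intro lipschitz_gradient_tendsto[OF H1] tendsto_Pair ub vb)
  have gu: "grad_u \<longlonglongrightarrow> fst (gradient G (ub, vb))"
    unfolding grad_u_def[abs_def] by (intro tendsto_fst grad_lim)
  have gv: "grad_v \<longlonglongrightarrow> snd (gradient G (ub, vb)) + gradient H vb"
    unfolding grad_v_def[abs_def]
    by (intro tendsto_add tendsto_snd grad_lim lipschitz_gradient_tendsto[OF H2] vb)
  have res: "residual \<longlonglongrightarrow> \<Theta> ub + B *v vb"
    unfolding residual_def[abs_def] by (intro tendsto_add Theta_lim B_lim ub vb)
  have feas: "\<Theta> ub + B *v vb = 0"
  proof -
    have "(\<lambda>k. p k + \<gamma> *\<^sub>R residual (Suc k)) \<longlonglongrightarrow> pb + \<gamma> *\<^sub>R (\<Theta> ub + B *v vb)"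
      by (intro tendsto_intros pb LIMSEQ_Suc[OF res])
    from LIMSEQ_unique[OF this p'[unfolded algD(7)]]
    have "pb + \<gamma> *\<^sub>R (\<Theta> ub + B *v vb) = pb" .
    then show ?thesis using gamma(1) by simp
  qed
  have qb: "q \<longlonglongrightarrow> pb"
  proof -
    have "(\<lambda>k. p k + \<gamma> *\<^sub>R residual k) \<longlonglongrightarrow> pb + \<gamma> *\<^sub>R (\<Theta> ub + B *v vb)"
      by (intro tendsto_intros pb res)
    then show ?thesis by (simp add: feas q_seq_def[abs_def] residual_def)
  qed
  have v_stat: "snd (gradient G (ub, vb)) + gradient H vb + transpose B *v pb = 0"
  proof -
    have "(\<lambda>k. \<gamma> *\<^sub>R (transpose B *v (\<Theta> (u (Suc k)) - \<Theta> (u k))) - grad_v k)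
        \<longlonglongrightarrow> \<gamma> *\<^sub>R (transpose B *v (\<Theta> ub - \<Theta> ub)) - (snd (gradient G (ub, vb)) + gradient H vb)"
      by (intro tendsto_diff[OF _ gv] tendsto_scaleR tendsto_const B_lim tendsto_diff Theta_lim u' ub)
    moreover have "(\<lambda>k. transpose B *v p (Suc k)) \<longlonglongrightarrow> transpose B *v pb" by (rule B_lim[OF p'])
    ultimately have "\<gamma> *\<^sub>R (transpose B *v (\<Theta> ub - \<Theta> ub))
        - (snd (gradient G (ub, vb)) + gradient H vb) = transpose B *v pb"
      unfolding multiplier_eq by (rule LIMSEQ_unique)
    then have "transpose B *v pb = - (snd (gradient G (ub, vb)) + gradient H vb)"
      by (simp add: matrix_vector_mult_diff_distrib)
    then show ?thesis by simp
  qed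
  obtain M where M: "(\<lambda>k. inv_step k / (\<sigma> * \<beta>)) \<longlonglongrightarrow> M"
  proof
    show "(\<lambda>k. inv_step k / (\<sigma> * \<beta>)) \<longlonglongrightarrow> (L\<^sub>G + norm pb * L\<^sub>\<Omega> + \<gamma> * L\<^sub>\<Theta>\<^sup>2
      + 14 * \<gamma> * b\<^sup>2 * L\<^sub>\<Theta>\<^sup>2 / lmin + 14 * (L\<^sub>G + \<gamma> * b * L\<^sub>\<Theta>)\<^sup>2 / (\<gamma> * lmin) + 1) / (\<sigma> * \<beta>)"
      unfolding inv_step_def using algD(1) K(1) by (intro tendsto_intros qb) auto
  qed
  \<comment> \<open>The smooth part of the limiting subproblem. The Bregman term has zero derivative
    at \<open>ub\<close>, so the weight \<open>M\<close> does not enter \<open>g\<close>.\<close>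
  define s where "s x = fst (gradient G (ub, vb)) \<bullet> x + pb \<bullet> (jacobian \<Omega> (at ub) *v x + \<Phi> x)
      + M * bregman K x ub" for x
  have K_diff: "K differentiable (at x)" for x using K(3) by (simp add: lipschitz_gradient_def)
  have \<Phi>_lim: "(\<lambda>k. \<Phi> (x k)) \<longlonglongrightarrow> \<Phi> a" if "x \<longlonglongrightarrow> a" for x a
    using isCont_tendsto_compose[OF differentiable_imp_continuous_within[OF diff(2)] that] .
  have K_lim: "(\<lambda>k. K (x k)) \<longlonglongrightarrow> K a" if "x \<longlonglongrightarrow> a" for x a
    using isCont_tendsto_compose[OF differentiable_imp_continuous_within[OF K_diff] that] .
  have jac_lim: "(\<lambda>k. jacobian \<Omega> (at (u k)) *v h k) \<longlonglongrightarrow> jacobian \<Omega> (at ub) *v a"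
    if "h \<longlonglongrightarrow> a" for h a
    by (rule jacobian_mult_tendsto[OF diff(1) H5(1) ub that])
  have s_min: "J ub + ereal (s ub) \<le> J x + ereal (s x)" if x: "x \<in> U" for x
  proof (cases "J x")
    case (real c)
    \<comment> \<open>From the subproblem inequality the nonnegative Bregman term at the new iterate
      is dropped, and the one at \<open>x\<close> gets the convergent larger weight.\<close>
    define \<rho> where "\<rho> k = grad_u k \<bullet> x + c + q k \<bullet> (jacobian \<Omega> (at (u k)) *v x + \<Phi> x)
        + inv_step k / (\<sigma> * \<beta>) * bregman K x (u k)
        - grad_u k \<bullet> u (Suc k) - q k \<bullet> (jacobian \<Omega> (at (u k)) *v u (Suc k) + \<Phi> (u (Suc k)))" for k
    have "J (u (Suc k)) \<le> ereal (\<rho> k)" for k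
    proof -
      have breg: "0 \<le> bregman K y (u k)" for y
        using bregman_ge[OF K(2) K_diff[of "u k"], of y] K(1)
        by (meson divide_nonneg_pos less_imp_le mult_nonneg_nonneg order_trans zero_le_power2 zero_less_numeral)
      have "0 \<le> 1 / \<epsilon> k * bregman K (u (Suc k)) (u k)"
        using breg eps_pos[of k] by (intro mult_nonneg_nonneg) auto
      moreover have "1 / \<epsilon> k * bregman K x (u k) \<le> inv_step k / (\<sigma> * \<beta>) * bregman K x (u k)"
        by (intro mult_right_mono inverse_eps_le breg)
      ultimately have "real_of_ereal (J (u (Suc k))) \<le> \<rho> k"
        using u_step[OF x real, of k] by (simp add: \<rho>_def)
      then show ?thesis using J_u_finite[of k] by (cases "J (u (Suc k))") auto
    qed
    moreover have "\<rho> \<longlonglongrightarrow> fst (gradient G (ub, vb)) \<bullet> x + c + pb \<bullet> (jacobian \<Omega> (at ub) *v x + \<Phi> x)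
        + M * bregman K x ub - fst (gradient G (ub, vb)) \<bullet> ub
        - pb \<bullet> (jacobian \<Omega> (at ub) *v ub + \<Phi> ub)"
      unfolding \<rho>_def bregman_def
      by (intro tendsto_add tendsto_diff tendsto_inner tendsto_mult tendsto_const gu qb M jac_lim
          \<Phi>_lim K_lim lipschitz_gradient_tendsto[OF K(3)] ub u')
    ultimately have "J ub \<le> ereal (fst (gradient G (ub, vb)) \<bullet> x + c
        + pb \<bullet> (jacobian \<Omega> (at ub) *v x + \<Phi> x) + M * bregman K x ub
        - fst (gradient G (ub, vb)) \<bullet> ub - pb \<bullet> (jacobian \<Omega> (at ub) *v ub + \<Phi> ub))"
      by (intro lsc_le_of_tendsto[OF H3(2) u'])
    moreover have "bregman K ub ub = 0" by (simp add: bregman_def)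
    ultimately show ?thesis using real J_ub by (cases "J ub") (auto simp: s_def)
  qed (use J_not_minf[of x] in auto)
  define g where "g = fst (gradient G (ub, vb)) + transpose (jacobian \<Theta> (at ub)) *v pb"
  have s_deriv: "(s has_derivative (\<lambda>h. g \<bullet> h)) (at ub)"
  proof -
    have D\<Phi>: "(\<Phi> has_derivative (\<lambda>h. jacobian \<Phi> (at ub) *v h)) (at ub)"
      by (rule has_derivative_jacobian[OF diff(2)])
    have D\<Theta>: "(\<Theta> has_derivative (\<lambda>h. jacobian \<Omega> (at ub) *v h + jacobian \<Phi> (at ub) *v h)) (at ub)"
      unfolding Theta by (intro has_derivative_add has_derivative_jacobian diff)
    then have "(\<Theta> has_derivative (\<lambda>h. jacobian \<Theta> (at ub) *v h)) (at ub)"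
      by (intro has_derivative_jacobian) (auto simp: differentiable_def)
    from fun_cong[OF has_derivative_unique[OF D\<Theta> this]]
    have jac: "jacobian \<Omega> (at ub) *v h + jacobian \<Phi> (at ub) *v h = jacobian \<Theta> (at ub) *v h" for h .
    have lin: "((\<lambda>x. jacobian \<Omega> (at ub) *v x) has_derivative (\<lambda>h. jacobian \<Omega> (at ub) *v h)) (at ub)"
      by (rule bounded_linear_imp_has_derivative[OF matrix_vector_mul_bounded_linear])
    have DK: "((\<lambda>x. bregman K x ub) has_derivative (\<lambda>h. 0)) (at ub)"
      unfolding bregman_def
      by (auto intro!: derivative_eq_intros has_derivative_gradient K_diff)
    have "(s has_derivative (\<lambda>h. fst (gradient G (ub, vb)) \<bullet> h
        + pb \<bullet> (jacobian \<Omega> (at ub) *v h + jacobian \<Phi> (at ub) *v h) + M * 0)) (at ub)"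
      unfolding s_def
      by (intro has_derivative_add has_derivative_inner_right has_derivative_mult_right D\<Phi> lin DK
          has_derivative_ident)
    then show ?thesis
      by (simp add: jac g_def inner_add_left inner_matrix_mult)
  qed
  obtain \<xi> \<zeta> where \<xi>: "\<xi> \<in> limiting_subdiff J ub" and \<zeta>: "\<zeta> \<in> normal_cone U ub" and sum: "g + \<xi> + \<zeta> = 0"
  proof (cases "U = UNIV")
    case True
    have "- g \<in> limiting_subdiff J ub"
      by (rule unconstrained_minimizer[where J = J and s = s, OF J_ub s_deriv]) (use s_min True in auto)
    then show ?thesis by (rule that[of _ 0]) (auto simp: normal_cone_def)
  next
    case False
    have "ub \<in> edom J \<inter> U" using ubU J_ub by (cases "J ub") (auto simp: edom_def)
    then have "lipschitz_around J ub" using H3(3)[OF False] by blast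
    from constrained_minimizer_lipschitz[OF U(2,3) ubU this s_deriv s_min] that
    show ?thesis by blast
  qed
  have "0 = gradient (\<lambda>x. G (x, vb)) ub + \<xi> + \<zeta> + transpose (jacobian \<Theta> (at ub)) *v pb"
    using sum by (simp add: gradient_fst[OF G] g_def algebra_simps)
  moreover have "0 = gradient (\<lambda>y. G (ub, y)) vb + gradient H vb + transpose B *v pb"
    using v_stat by (simp add: gradient_snd[OF G])
  ultimately show ?thesis
    unfolding stationary_point_def using ubU feas \<xi> \<zeta> by auto
qed

end

theorem theorem5p1:
  fixes U :: "(real ^ 'n) set"
    and G :: "(real ^ 'n) \<times> (real ^ 'd) \<Rightarrow> real"
    and J :: "real ^ 'n \<Rightarrow> ereal"
    and H :: "real ^ 'd \<Rightarrow> real"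
    and \<Omega> \<Phi> \<Theta> :: "real ^ 'n \<Rightarrow> real ^ 'm"
    and B :: "real ^ 'd ^ 'm"
    and K :: "real ^ 'n \<Rightarrow> real"
    and L\<^sub>G L\<^sub>H L\<^sub>\<Theta> L\<^sub>\<Omega> L\<^sub>K \<beta> \<gamma> \<sigma> lmin c1 c2 :: real
    and L\<^sub>\<Omega>\<^sub>j :: "'m \<Rightarrow> real"
    and \<delta> \<epsilon> :: "nat \<Rightarrow> real"
    and u :: "nat \<Rightarrow> real ^ 'n"
    and v :: "nat \<Rightarrow> real ^ 'd"
    and p :: "nat \<Rightarrow> real ^ 'm"
    and w :: "nat \<Rightarrow> (real ^ 'n) \<times> (real ^ 'd) \<times> (real ^ 'm)"
    and \<L> :: "(real ^ 'n) \<times> (real ^ 'd) \<times> (real ^ 'm) \<Rightarrow> ereal"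
    and \<Lambda> :: "nat \<Rightarrow> ereal"
    and \<Lambda>\<^sub>s \<kappa>\<^sub>1 \<eta> \<nu> :: real
    and wbar :: "(real ^ 'n) \<times> (real ^ 'd) \<times> (real ^ 'm)"
  \<comment> \<open>problem data\<close>
  assumes U: "U \<noteq> {}" "closed U" "convex U"
    and Theta: "\<Theta> = (\<lambda>x. \<Omega> x + \<Phi> x)"
    and diff: "\<And>x. \<Omega> differentiable (at x)" "\<And>x. \<Phi> differentiable (at x)"
  \<comment> \<open>first assumption\<close>
    and H1: "lipschitz_gradient L\<^sub>G G"
    and H2: "lipschitz_gradient L\<^sub>H H"
    and H3: "proper J" "lsc J"
            "U = UNIV \<Longrightarrow> convex (edom J)"
            "U \<noteq> UNIV \<Longrightarrow> \<forall>x \<in> edom J \<inter> U. lipschitz_around J x"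
    and H4: "L\<^sub>\<Theta>-lipschitz_on UNIV \<Theta>"
    and H5: "\<And>j. lipschitz_gradient (L\<^sub>\<Omega>\<^sub>j j) (\<lambda>x. \<Omega> x $ j)"
            "L\<^sub>\<Omega> = (\<Sum>j\<in>UNIV. L\<^sub>\<Omega>\<^sub>j j)"
    and H6: "CARD('d) \<le> CARD('m)" "rank B = CARD('d)" "range \<Theta> \<subseteq> range ((*v) B)"
    and H7: "bounded_below_over (objective G J H) (constraint_set \<Theta> B)"
            "coercive_over (objective G J H) (constraint_set \<Theta> B)"
  \<comment> \<open>second assumption\<close>
    and lmin: "lmin = lambda_min (transpose B ** B)"
    and K: "\<beta> > 0" "strongly_convex \<beta> K" "lipschitz_gradient L\<^sub>K K"
    and gamma: "\<gamma> > 0" "\<gamma> > (sqrt 57 + 1) / (2 * lmin) * (L\<^sub>G + L\<^sub>H)"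
  \<comment> \<open>the sequence generated by the algorithm\<close>
    and alg: "napp_al U G J H \<Omega> \<Phi> B K \<gamma> \<sigma> \<delta> \<epsilon> u v p"
    and delta: "\<And>k. \<delta> k = \<beta> * inverse
          (L\<^sub>G + norm (q_seq \<Theta> B \<gamma> u v p k) * L\<^sub>\<Omega> + \<gamma> * L\<^sub>\<Theta>\<^sup>2
            + 14 * \<gamma> * (spectral_norm B)\<^sup>2 * L\<^sub>\<Theta>\<^sup>2 / lmin
            + 14 * (L\<^sub>G + \<gamma> * spectral_norm B * L\<^sub>\<Theta>)\<^sup>2 / (\<gamma> * lmin) + 1)"
    and w: "w = (\<lambda>k. (u k, v k, p k))"
  \<comment> \<open>the merit values and their limit\<close>
    and L: "\<L> = aug_lagrangian G J H \<Theta> B \<gamma>"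
    and c1: "c1 = 7 * (L\<^sub>G + \<gamma> * spectral_norm B * L\<^sub>\<Theta>)\<^sup>2 / (\<gamma> * lmin)"
    and c2: "c2 = 7 * (L\<^sub>G + L\<^sub>H)\<^sup>2 / (\<gamma> * lmin)"
    and Lambda: "\<And>k. k \<ge> 1 \<Longrightarrow> \<Lambda> k = \<L> (u k, v k, p k) +
          ereal (c1 * (norm (u (k - 1) - u k))\<^sup>2 + c2 * (norm (v (k - 1) - v k))\<^sup>2
                 + 1 / (2 * \<gamma>) * (norm (p (k - 1) - p k))\<^sup>2)"
    and Lambda_s: "ereal \<Lambda>\<^sub>s = lim \<Lambda>"
  \<comment> \<open>the accumulation point and the error bound\<close>
    and acc: "\<exists>r. strict_mono r \<and> (w \<circ> r) \<longlonglongrightarrow> wbar"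
    and val: "\<L> wbar = ereal \<Lambda>\<^sub>s"
    and eb: "vp_eb \<L> \<Lambda>\<^sub>s w wbar \<kappa>\<^sub>1 \<eta> \<nu>"
  shows
    "(\<exists>k0. \<forall>k\<ge>k0. w k \<in> ball wbar \<eta> \<and> \<L> (w k) < ereal (\<Lambda>\<^sub>s + \<nu>))
     \<and> summable (\<lambda>k. norm (w k - w (Suc k)))
     \<and> (w \<longlonglongrightarrow> wbar \<and> stationary_point U G J H \<Theta> B wbar)
     \<and> (\<Lambda> \<longlonglongrightarrow> ereal \<Lambda>\<^sub>s
         \<and> (\<exists>\<alpha>\<in>{0<..<1}. \<exists>k0\<ge>1. \<forall>k\<ge>k0.
              \<Lambda> (Suc k) - ereal \<Lambda>\<^sub>s \<le> ereal \<alpha> * (\<Lambda> k - ereal \<Lambda>\<^sub>s)))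
     \<and> (\<exists>C>0. \<exists>\<rho>\<in>{0<..<1}. \<exists>k0. \<forall>k\<ge>k0. norm (w k - wbar) \<le> C * \<rho> ^ k)"
proof -

  \<comment> \<open>Feasibility of the accumulation point and finite-valued forms\<close>
  obtain ub vb pb where wb: "wbar = (ub, vb, pb)" by (cases wbar)
  obtain r where r: "strict_mono r" and wr: "(w \<circ> r) \<longlonglongrightarrow> wbar" using acc by blast
  \<comment> \<open>A real value of the Lagrangian excludes both infinities for
    \<open>J ub\<close>.\<close>
  have J_ub: "\<bar>J ub\<bar> \<noteq> \<infinity>"
    using val by (cases "J ub") (auto simp: L wb aug_lagrangian_def objective_def)
  have "ub \<in> U"
  proof (rule closed_sequentially[OF U(2)])
    have "(\<lambda>k. u (r k)) \<longlonglongrightarrow> ub" using tendsto_fst[OF wr] by (simp add: w wb o_def)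
    \<comment> \<open>The shift makes the indices positive; \<open>u 0\<close> need not lie in
      \<open>U\<close>.\<close>
    then show "(\<lambda>k. u (r (Suc k))) \<longlonglongrightarrow> ub" by (rule LIMSEQ_Suc)
    show "u (r (Suc k)) \<in> U" for k
    proof -
      have "0 < r (Suc k)" using seq_suble[OF r, of "Suc k"] by simp
      then obtain i where "r (Suc k) = Suc i" using gr0_implies_Suc by blast
      then show ?thesis using alg by (auto simp: napp_al_def Let_def is_arg_min_def)
    qed
  qed
  moreover have "J ub < \<infinity>" using J_ub by auto
  ultimately have feasible: "\<exists>x\<in>U. J x < \<infinity>" by blast
  interpret napp_run U G J H \<Omega> \<Phi> \<Theta> B K L\<^sub>G L\<^sub>H L\<^sub>\<Theta> L\<^sub>\<Omega> L\<^sub>K \<beta> \<gamma> \<sigma> lmin L\<^sub>\<Omega>\<^sub>j \<delta> \<epsilon> u v p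
    by unfold_locales (fact U Theta diff H1 H2 H3 H4 H5 H6 lmin K gamma alg delta feasible)+
  have L_eq: "\<L> (x, y, z) = ereal (lagr (x, y, z))" if "\<bar>J x\<bar> \<noteq> \<infinity>" for x y z
    using that by (cases "J x") (auto simp: L aug_lagrangian_def objective_def lagr_def)
  have Lw: "\<L> (w (Suc k)) = ereal (lagr (w (Suc k)))" for k
    using J_u_finite by (simp add: w L_eq)
  have Lam: "\<Lambda> (Suc k) = ereal (merit (Suc k))" for k
    using J_u_finite[of k] by (simp add: Lambda L_eq merit_def C1_def C2_def c1 c2)

  \<comment> \<open>Monotonicity and limit of the merit values\<close>
  have descent: "merit (Suc (Suc k)) + slack * (norm (w (Suc k) - w (Suc (Suc k))))\<^sup>2 \<le> merit (Suc k)" for k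
    using merit_descent[of k] by (simp add: w)
  have "merit (Suc (Suc k)) \<le> merit (Suc k)" for k
  proof -
    have "0 \<le> slack * (norm (w (Suc k) - w (Suc (Suc k))))\<^sup>2" using slack_pos by simp
    with descent[of k] show ?thesis by linarith
  qed
  then have dec: "decseq (\<lambda>k. \<Lambda> (Suc k))" by (simp add: decseq_Suc_iff Lam)
  \<comment> \<open>\<open>lim\<close> is a definite description, so existence comes first: a
    decreasing extended-real sequence tends to its infimum.\<close>
  have Lam_lim: "\<Lambda> \<longlonglongrightarrow> ereal \<Lambda>\<^sub>s"
  proof -
    have "\<Lambda> \<longlonglongrightarrow> (INF k. \<Lambda> (Suc k))"
      using LIMSEQ_INF[OF dec] by (rule LIMSEQ_imp_Suc)
    then show ?thesis unfolding Lambda_s by (simp add: limI)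
  qed
  have "(\<lambda>k. ereal (merit (Suc k))) \<longlonglongrightarrow> ereal \<Lambda>\<^sub>s"
    using LIMSEQ_Suc[OF Lam_lim] by (simp add: Lam)
  then have merit_lim: "merit \<longlonglongrightarrow> \<Lambda>\<^sub>s" by (intro LIMSEQ_imp_Suc[of merit]) simp
  have merit_ge: "\<Lambda>\<^sub>s \<le> merit (Suc k)" for k
    using decseq_ge[OF dec LIMSEQ_Suc[OF Lam_lim], of k] by (simp add: Lam)
  define \<phi> where "\<phi> k = merit k - \<Lambda>\<^sub>s" for k
  have \<phi>_lim: "\<phi> \<longlonglongrightarrow> 0"
    unfolding \<phi>_def[abs_def] using tendsto_diff[OF merit_lim tendsto_const[of \<Lambda>\<^sub>s]] by simp
  define D where "D k = (norm (w k - w (Suc k)))\<^sup>2" for k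
  have D_lim: "D \<longlonglongrightarrow> 0"
  proof (rule LIMSEQ_imp_Suc, rule tendsto_sandwich[of "\<lambda>_. 0"])
    show "\<forall>\<^sub>F k in sequentially. D (Suc k) \<le> (\<phi> (Suc k) - \<phi> (Suc (Suc k))) / slack"
      using descent slack_pos by (auto simp: D_def \<phi>_def pos_le_divide_eq algebra_simps)
    have "(\<lambda>k. (\<phi> (Suc k) - \<phi> (Suc (Suc k))) / slack) \<longlonglongrightarrow> (0 - 0) / slack"
      using slack_pos by (intro tendsto_intros LIMSEQ_Suc \<phi>_lim) auto
    then show "(\<lambda>k. (\<phi> (Suc k) - \<phi> (Suc (Suc k))) / slack) \<longlonglongrightarrow> 0" by simp
  qed (auto simp: D_def)

  \<comment> \<open>Comparison of merit values with the Lagrangian\<close>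
  define C where "C = C1 + C2 + 1 / (2 * \<gamma>)"
  have C_nonneg: "0 \<le> C1" "0 \<le> C2" "0 \<le> 1 / (2 * \<gamma>)" "0 \<le> C"
    using gamma(1) lmin_pos by (auto simp: C_def C1_def C2_def)
  have merit_lagr: "lagr (w (Suc k)) \<le> merit (Suc k)"
    "merit (Suc k) \<le> lagr (w (Suc k)) + C * D k" for k
  proof -
    have D: "D k = (norm (u k - u (Suc k)))\<^sup>2 + (norm (v k - v (Suc k)))\<^sup>2 + (norm (p k - p (Suc k)))\<^sup>2"
      by (simp add: D_def w norm_triple_squared)
    have m: "merit (Suc k) = lagr (w (Suc k)) + (C1 * (norm (u k - u (Suc k)))\<^sup>2
        + C2 * (norm (v k - v (Suc k)))\<^sup>2 + 1 / (2 * \<gamma>) * (norm (p k - p (Suc k)))\<^sup>2)"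
      by (simp add: merit_def w)
    show "lagr (w (Suc k)) \<le> merit (Suc k)"
      unfolding m using C_nonneg by (intro le_add_same_cancel1[THEN iffD2] add_nonneg_nonneg
          mult_nonneg_nonneg) auto
    have "C1 * (norm (u k - u (Suc k)))\<^sup>2 \<le> C * (norm (u k - u (Suc k)))\<^sup>2"
      "C2 * (norm (v k - v (Suc k)))\<^sup>2 \<le> C * (norm (v k - v (Suc k)))\<^sup>2"
      "1 / (2 * \<gamma>) * (norm (p k - p (Suc k)))\<^sup>2 \<le> C * (norm (p k - p (Suc k)))\<^sup>2"
      by (rule mult_right_mono; use C_nonneg in \<open>simp add: C_def\<close>)+
    then show "merit (Suc k) \<le> lagr (w (Suc k)) + C * D k"
      unfolding m D distrib_left by linarith
  qed

  \<comment> \<open>Error bound and linear convergence\<close>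
  have pos: "0 < \<kappa>\<^sub>1" "0 < \<eta>" "0 < \<nu>"
    and eb': "\<And>k. w (Suc k) \<in> ball wbar \<eta> \<Longrightarrow> \<L> (w (Suc k)) < ereal (\<Lambda>\<^sub>s + \<nu>) \<Longrightarrow>
          \<L> (w (Suc k)) - ereal \<Lambda>\<^sub>s \<le> ereal (\<kappa>\<^sub>1 * (norm (w k - w (Suc k)))\<^sup>2)"
    using eb unfolding vp_eb_def by blast+
  \<comment> \<open>The Lagrangian lies below the merit value, so the value condition of the error
    bound holds at all late indices; only the ball condition is left to the convergence
    lemma.\<close>
  obtain N0 where N0: "\<And>k. N0 \<le> k \<Longrightarrow> merit k < \<Lambda>\<^sub>s + \<nu>"
    using order_tendstoD(2)[OF merit_lim, of "\<Lambda>\<^sub>s + \<nu>"] pos(3) by (auto simp: eventually_sequentially)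
  define N where "N = Suc N0"
  have low: "\<L> (w k) < ereal (\<Lambda>\<^sub>s + \<nu>)" if k: "N \<le> k" for k
  proof -
    obtain i where i: "k = Suc i" using k by (cases k) (auto simp: N_def)
    show ?thesis using N0[of k] k merit_lagr(1)[of i] by (simp add: i Lw N_def)
  qed
  \<comment> \<open>The merit exceeds the Lagrangian by at most \<open>C * D k\<close>, so it
    satisfies the error bound with this enlarged constant.\<close>
  have "0 < \<kappa>\<^sub>1 + C" using pos C_nonneg by simp
  obtain k0 \<alpha> \<rho> C' where k0: "N \<le> k0" and \<alpha>: "0 < \<alpha>" "\<alpha> < 1" and \<rho>: "0 < \<rho>" "\<rho> < 1" and C': "0 < C'"
    and ball: "\<And>k. k0 \<le> k \<Longrightarrow> w k \<in> ball wbar \<eta>"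
    and qlin: "\<And>k. k0 \<le> k \<Longrightarrow> \<phi> (Suc k) \<le> \<alpha> * \<phi> k"
    and sum: "summable (\<lambda>k. norm (w k - w (Suc k)))"
    and conv: "w \<longlonglongrightarrow> wbar"
    and rlin: "\<And>k. k0 \<le> k \<Longrightarrow> norm (w k - wbar) \<le> C' * \<rho> ^ k"
  proof (rule error_bound_linear_convergence[OF slack_pos \<open>0 < \<kappa>\<^sub>1 + C\<close> pos(2) _ _ \<phi>_lim _ r wr])
    fix k assume k: "N \<le> k"
    obtain i where i: "k = Suc i" using k by (cases k) (auto simp: N_def)
    show "0 \<le> \<phi> k" using merit_ge[of i] by (simp add: \<phi>_def i)
    show "\<phi> (Suc k) + slack * (norm (w k - w (Suc k)))\<^sup>2 \<le> \<phi> k"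
      using descent[of i] by (simp add: \<phi>_def i)
    assume "w (Suc k) \<in> ball wbar \<eta>"
    from eb'[OF this low] k have "lagr (w (Suc k)) - \<Lambda>\<^sub>s \<le> \<kappa>\<^sub>1 * D k"
      by (simp add: Lw D_def)
    then show "\<phi> (Suc k) \<le> (\<kappa>\<^sub>1 + C) * (norm (w k - w (Suc k)))\<^sup>2"
      using merit_lagr(2)[of k] by (simp add: \<phi>_def D_def distrib_right)
  qed (rule that)

  \<comment> \<open>Stationarity and conclusion\<close>
  have lims: "u \<longlonglongrightarrow> ub" "v \<longlonglongrightarrow> vb" "p \<longlonglongrightarrow> pb"
    using tendsto_fst[OF conv] tendsto_fst[OF tendsto_snd[OF conv]] tendsto_snd[OF tendsto_snd[OF conv]]
    by (simp_all add: w wb)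
  have "stationary_point U G J H \<Theta> B wbar" unfolding wb by (rule stationary_limit[OF lims J_ub])
  moreover have "\<Lambda> (Suc k) - ereal \<Lambda>\<^sub>s \<le> ereal \<alpha> * (\<Lambda> k - ereal \<Lambda>\<^sub>s)" if k: "k0 \<le> k" for k
  proof -
    obtain i where i: "k = Suc i" using k k0 by (cases k) (auto simp: N_def)
    show ?thesis using qlin[OF k] by (simp add: i Lam \<phi>_def)
  qed
  moreover have "1 \<le> k0" using k0 by (simp add: N_def)
  moreover have "w k \<in> ball wbar \<eta> \<and> \<L> (w k) < ereal (\<Lambda>\<^sub>s + \<nu>)" if "k0 \<le> k" for k
    using ball[OF that] low that k0 by simp
  ultimately show ?thesis
    using sum conv Lam_lim \<alpha> \<rho> C' rlin by (meson greaterThanLessThan_iff)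
qed

end
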